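(* Consider the gossip algorithm described in the context, under the standing assumptions stated there (including strict monotonicity of $F$ and the Lipschitz conditions). Let $x^*$ be the Nash equilibrium of the game. Then the sequence of action profiles $\{x(k)\}$ generated by the algorithm converges to $x^*$ almost surely.
   Context: Graphs and matrices. Let $V=\{1,\ldots,N\}$, $N\ge2$, and let $G_I=(V,E_I)$ (interference graph) be a connected undirected graph which is not complete, with adjacency matrix $A$; $B=A+I_N$. For $i\in V$: $N_I(i)$ is the neighbor set of $i$ in $G_I$, $\tilde N_I(i)=N_I(i)\cup\{i\}$, $m_i=\deg_{G_I}(i)+1$; $m=\sum_i m_i$. For $i,j\in V$: $s_{ij}=\sum_{l=1}^{j}B(i,l)+\sum_{r=1}^{i-1}m_r$; $E_j^i=e_{s_{ij}}\in\mathbb{R}^m$ if $j\in\tilde N_I(i)$, $E_j^i=\mathbf 0_m$ otherwise. The communication graph $G_C=(V,E_C)$ satisfies $G_m\subseteq G_C\subseteq G_I$ for a maximal triangle-free spanning subgraph $G_m$ of $G_I$ (triangle-free, spanning, and adding any edge of $G_I$ not in $G_m$ creates a triangle); $N_C(i)$ is the neighbor set of $i$ in $G_C$. $\mathrm{ind}(i,j)=\tilde N_I(i)\cap\tilde N_I(j)$ and $W_{ij}=I_m-\tfrac12\sum_{l\in\mathrm{ind}(i,j)}(E_l^i-E_l^j)(E_l^i-E_l^j)^T$. Game. Player $i$ has action set $\Omega_i\subset\mathbb{R}$, nonempty, compact and convex; $\Omega=\prod_i\Omega_i$. Player $i$'s cost is $J_i:\Omega^i\to\mathbb{R}$, $\Omega^i=\prod_{j\in\tilde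 N_I(i)}\Omega_j$, written $J_i(x_i,x_{-i}^i)$ with $x_{-i}^i\in\Omega_{-i}^i=\prod_{j\in N_I(i)}\Omega_j$; $J_i$ is continuously differentiable in $x_i$, jointly continuous in $x^i$, and convex in $x_i$ for every $x_{-i}^i$. The pseudo-gradient $F:\Omega\to\mathbb{R}^N$, $F(x)=(\nabla_{x_i}J_i(x^i))_{i\in V}$, is strictly monotone: $(F(x)-F(y))^T(x-y)>0$ for all $x\ne y$ in $\Omega$. For each $i$, $\nabla_{x_i}J_i(x_i,u)$ is Lipschitz in $x_i\in\Omega_i$ (constant $\sigma_i>0$) for each fixed $u\in\Omega_{-i}^i$, and Lipschitz in $u$ (constant $L_i>0$) for each fixed $x_i\in\Omega_i$. A Nash equilibrium is $x^*\in\Omega$ with $J_i(x_i^*,x_{-i}^{i*})\le J_i(x_i,x_{-i}^{i*})$ for all $x_i\in\Omega_i$ and all $i\in V$; under these assumptions it is unique. $T_{\Omega_i}$ denotes Euclidean projection onto $\Omega_i$. Algorithm. The state is $\tilde x(k)\in\mathbb{R}^m$, whose entry at position $s_{ij}$ ($i\in V$, $j\in\tilde N_I(i)$) is $\tilde x_j^i(k)\in\Omega_j$; the actions are $x_i(k)=\tilde x_i^i(k)$ and $x(k)=(x_1(k),\dots,x_N(k))$. Initial values $\tilde x^i(0)\in\Omega^i$ are arbitrary. At iteration $k$: $i_k$ is drawn uniformly from $V$ and $j_k$ uniformly from $N_C(i_k)$, independently of the past; $W(k)=W_{i_kj_k}$; $\bar x(k)=W(k)\tilde x(k)$; $\hat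 x_{-i}^i(k)=(\bar x_{s_{ij}}(k))_{j\in N_I(i)}$; for $i\in\{i_k,j_k\}$, $x_i(k+1)=T_{\Omega_i}[x_i(k)-\alpha_{k,i}\nabla_{x_i}J_i(x_i(k),\hat x_{-i}^i(k))]$, and $x_i(k+1)=x_i(k)$ otherwise; then $\tilde x_j^i(k+1)=\bar x_{s_{ij}}(k)$ for $j\in N_I(i)$ and $\tilde x_i^i(k+1)=x_i(k+1)$. The step sizes are $\alpha_{k,i}=1/\nu_k(i)$, where $\nu_k(i)$ is the number of updates player $i$ has made up to time $k$; they satisfy $\sum_k\alpha_{k,i}^2<\infty$ and $\sum_k\alpha_{k,i}=\infty$ for all $i$. *)

theory Defs
  imports "HOL-Probability.Probability"
begin

section \<open>Graphs (vertex set V = {1..N}, undirected graphs as symmetric irreflexive edge sets)\<close>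

definition simple_graph :: "nat set \<Rightarrow> (nat \<times> nat) set \<Rightarrow> bool" where
  "simple_graph V E \<longleftrightarrow> E \<subseteq> V \<times> V \<and> sym E \<and> (\<forall>x. (x, x) \<notin> E)"

definition graph_connected :: "nat set \<Rightarrow> (nat \<times> nat) set \<Rightarrow> bool" where
  "graph_connected V E \<longleftrightarrow> (\<forall>u\<in>V. \<forall>v\<in>V. (u, v) \<in> E\<^sup>*)"

definition graph_complete :: "nat set \<Rightarrow> (nat \<times> nat) set \<Rightarrow> bool" where
  "graph_complete V E \<longleftrightarrow> (\<forall>u\<in>V. \<forall>v\<in>V. u \<noteq> v \<longrightarrow> (u, v) \<in> E)"

definition triangle_free :: "(nat \<times> nat) set \<Rightarrow> bool" where
  "triangle_free E \<longleftrightarrow> \<not> (\<exists>a b c. (a, b) \<in> E \<and> (b, c) \<in> E \<and> (a, c) \<in> E)"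

text \<open>Maximal triangle-free spanning subgraph (V, Em) of (V, EI).\<close>
definition max_triangle_free_spanning_subgraph ::
  "nat set \<Rightarrow> (nat \<times> nat) set \<Rightarrow> (nat \<times> nat) set \<Rightarrow> bool" where
  "max_triangle_free_spanning_subgraph V EI Em \<longleftrightarrow>
     simple_graph V Em \<and> Em \<subseteq> EI \<and> triangle_free Em \<and>
     (\<forall>a b. (a, b) \<in> EI - Em \<longrightarrow> \<not> triangle_free (Em \<union> {(a, b), (b, a)}))"

text \<open>Neighbour sets N_I(i) and closed neighbourhoods of the interference graph.\<close>
definition nbrs :: "(nat \<times> nat) set \<Rightarrow> nat \<Rightarrow> nat set" where
  "nbrs E i = {j. (i, j) \<in> E}"

definition cnbrs :: "(nat \<times> nat) set \<Rightarrow> nat \<Rightarrow> nat set" where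
  "cnbrs E i = insert i (nbrs E i)"

section \<open>Indices, unit vectors and gossip matrices (vectors in R^m as nat => real, entries 1..m)\<close>

text \<open>B = A + I\<close>
definition Bmat :: "(nat \<times> nat) set \<Rightarrow> nat \<Rightarrow> nat \<Rightarrow> nat" where
  "Bmat EI i l = (if (i, l) \<in> EI \<or> i = l then 1 else 0)"

text \<open>m_i = deg(i) + 1\<close>
definition mdeg :: "(nat \<times> nat) set \<Rightarrow> nat \<Rightarrow> nat" where
  "mdeg EI i = card (nbrs EI i) + 1"

definition mtot :: "nat \<Rightarrow> (nat \<times> nat) set \<Rightarrow> nat" where
  "mtot N EI = (\<Sum>i\<in>{1..N}. mdeg EI i)"

text \<open>s_ij = sum_{l=1}^j B(i,l) + sum_{r=1}^{i-1} m_r\<close>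
definition sidx :: "(nat \<times> nat) set \<Rightarrow> nat \<Rightarrow> nat \<Rightarrow> nat" where
  "sidx EI i j = (\<Sum>l\<in>{1..j}. Bmat EI i l) + (\<Sum>r\<in>{1..<i}. mdeg EI r)"

text \<open>E^i_j (unit vector e_{s_ij} if j in closed neighbourhood of i, else 0); position p.\<close>
definition Evec :: "(nat \<times> nat) set \<Rightarrow> nat \<Rightarrow> nat \<Rightarrow> nat \<Rightarrow> real" where
  "Evec EI i j p = (if j \<in> cnbrs EI i \<and> p = sidx EI i j then 1 else 0)"

definition ind :: "(nat \<times> nat) set \<Rightarrow> nat \<Rightarrow> nat \<Rightarrow> nat set" where
  "ind EI i j = cnbrs EI i \<inter> cnbrs EI j"

text \<open>W_ij = I_m - 1/2 sum_{l in ind(i,j)} (E^i_l - E^j_l)(E^i_l - E^j_l)^T, entry (p,q)\<close>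
definition Wmat :: "(nat \<times> nat) set \<Rightarrow> nat \<Rightarrow> nat \<Rightarrow> nat \<Rightarrow> nat \<Rightarrow> real" where
  "Wmat EI i j p q = (if p = q then 1 else 0)
     - 1/2 * (\<Sum>l\<in>ind EI i j. (Evec EI i l p - Evec EI j l p) * (Evec EI i l q - Evec EI j l q))"

section \<open>The game\<close>

text \<open>Pseudo-gradient F(x)_i = grad_{x_i} J_i(x_i, x^i_{-i}); dJ i xi u is the partial derivative
  of J_i in its own action, u the neighbours' actions (an element of Pi_E (N_I(i)) Omega).\<close>
definition pseudo_grad ::
  "(nat \<times> nat) set \<Rightarrow> (nat \<Rightarrow> real \<Rightarrow> (nat \<Rightarrow> real) \<Rightarrow> real) \<Rightarrow> (nat \<Rightarrow> real) \<Rightarrow> nat \<Rightarrow> real" where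
  "pseudo_grad EI dJ x i = dJ i (x i) (restrict x (nbrs EI i))"

definition is_nash_eq ::
  "nat \<Rightarrow> (nat \<times> nat) set \<Rightarrow> (nat \<Rightarrow> real set) \<Rightarrow> (nat \<Rightarrow> real \<Rightarrow> (nat \<Rightarrow> real) \<Rightarrow> real)
     \<Rightarrow> (nat \<Rightarrow> real) \<Rightarrow> bool" where
  "is_nash_eq N EI \<Omega> J xs \<longleftrightarrow> xs \<in> (\<Pi>\<^sub>E i\<in>{1..N}. \<Omega> i) \<and>
     (\<forall>i\<in>{1..N}. \<forall>xi\<in>\<Omega> i.
        J i (xs i) (restrict xs (nbrs EI i)) \<le> J i xi (restrict xs (nbrs EI i)))"

section \<open>The gossip algorithm\<close>

text \<open>One iteration with selected pair (a,b) = (i_k, j_k) and step sizes alpha i.\<close>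
definition gossip_step ::
  "nat \<Rightarrow> (nat \<times> nat) set \<Rightarrow> (nat \<Rightarrow> real set) \<Rightarrow> (nat \<Rightarrow> real \<Rightarrow> (nat \<Rightarrow> real) \<Rightarrow> real)
     \<Rightarrow> (nat \<Rightarrow> real) \<Rightarrow> nat \<times> nat \<Rightarrow> (nat \<Rightarrow> real) \<Rightarrow> (nat \<Rightarrow> real)" where
  "gossip_step N EI \<Omega> dJ \<alpha> ab xt =
     (let a = fst ab; b = snd ab;
          xbar = (\<lambda>p. \<Sum>q\<in>{1..mtot N EI}. Wmat EI a b p q * xt q);
          xhat = (\<lambda>i. restrict (\<lambda>j. xbar (sidx EI i j)) (nbrs EI i));
          xnew = (\<lambda>i. if i \<in> {a, b}
                       then closest_point (\<Omega> i) (xt (sidx EI i i) - \<alpha> i * dJ i (xt (sidx EI i i)) (xhat i))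
                       else xt (sidx EI i i))
      in (\<lambda>p. if \<exists>i\<in>{1..N}. p = sidx EI i i
              then xnew (THE i. i \<in> {1..N} \<and> p = sidx EI i i)
              else xbar p))"

text \<open>nu_k(i): number of updates of player i up to and including iteration k.\<close>
definition num_updates :: "(nat \<times> nat) stream \<Rightarrow> nat \<Rightarrow> nat \<Rightarrow> nat" where
  "num_updates \<omega> k i = card {t. t \<le> k \<and> (fst (\<omega> !! t) = i \<or> snd (\<omega> !! t) = i)}"

text \<open>State trajectory tilde x(k) along a sample path omega = ((i_0,j_0),(i_1,j_1),...).\<close>
primrec gossip_traj ::
  "nat \<Rightarrow> (nat \<times> nat) set \<Rightarrow> (nat \<Rightarrow> real set) \<Rightarrow> (nat \<Rightarrow> real \<Rightarrow> (nat \<Rightarrow> real) \<Rightarrow> real)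
     \<Rightarrow> (nat \<Rightarrow> real) \<Rightarrow> (nat \<times> nat) stream \<Rightarrow> nat \<Rightarrow> (nat \<Rightarrow> real)" where
  "gossip_traj N EI \<Omega> dJ x0 \<omega> 0 = x0"
| "gossip_traj N EI \<Omega> dJ x0 \<omega> (Suc k) =
     gossip_step N EI \<Omega> dJ (\<lambda>i. 1 / real (num_updates \<omega> k i)) (\<omega> !! k) (gossip_traj N EI \<Omega> dJ x0 \<omega> k)"

text \<open>Distribution of (i_k, j_k): i_k uniform on V, j_k uniform on N_C(i_k).\<close>
definition select_pmf :: "nat \<Rightarrow> (nat \<times> nat) set \<Rightarrow> (nat \<times> nat) pmf" where
  "select_pmf N EC = pmf_of_set {1..N} \<bind> (\<lambda>i. map_pmf (\<lambda>j. (i, j)) (pmf_of_set (nbrs EC i)))"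

text \<open>Sample space: i.i.d. sequences of selections.\<close>
definition gossip_space :: "nat \<Rightarrow> (nat \<times> nat) set \<Rightarrow> (nat \<times> nat) stream measure" where
  "gossip_space N EC = stream_space (measure_pmf (select_pmf N EC))"

end

theory Submission
  imports Defs
begin

text \<open>
  The argument is pathwise. Almost surely every player is selected with a positive asymptotic
  frequency and every finite word of communicating pairs occurs as a block with a positive
  asymptotic frequency (Hoeffding and Borel--Cantelli); the rest is deterministic.

  The estimates of the action of a player \<open>j\<close> perform an averaging process on the closed
  neighbourhood of \<open>j\<close> whose leader \<open>j\<close> moves by \<open>O(1/k)\<close>. By maximality of the triangle-free
  subgraph, \<open>j\<close> reaches every neighbour inside this neighbourhood by at most two communication
  edges, so some word of pairs contracts all errors by a fixed factor. As it recurs with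
  positive frequency, the errors tend to 0.

  The steps \<open>1/\<nu>\<close> of a player add up to harmonic numbers, so, given a positive asymptotic
  frequency, they differ from \<open>1/k\<close> by a convergent series. Summation by parts therefore
  gives a modification \<open>U\<close> of the squared distance to the equilibrium, asymptotically equal to
  it, with \<open>U (k + 1) \<le> U k - (2 \<phi> (x k) - o(1)) / (k + 1)\<close>, where
  \<open>\<phi> x = (\<Sum>i. F x i * (x i - xstar i))\<close> is bounded away from 0 off each neighbourhood of the
  equilibrium by strict monotonicity and compactness.
\<close>

section \<open>Block frequencies of i.i.d. sequences\<close>

text \<open>Strict monotonicity weighs all players equally, whereas an iteration moves only two of
  them, with random steps that need not agree. The deviations from the common weight
  \<open>1/k\<close> are of order \<open>1/k\<close> themselves, since an idle player has step 0, so
  they need not be absolutely summable and only the convergence of their signed sums can be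
  exploited. Monotonicity provides no rate, but none is needed: estimation errors enter multiplied
  by steps of order \<open>1/k\<close>, so it is enough that they vanish. Two players can average
  their estimates of the action of \<open>j\<close> only if both hold one. Connectedness of the
  communication graph as a whole is therefore not enough: news about \<open>j\<close> has to travel
  inside its closed neighbourhood.\<close>

lemma measurable_stake_pmf:
  fixes p :: "'a::countable pmf"
  shows "stake l \<in> measurable (stream_space (measure_pmf p)) (count_space UNIV)"
proof -
  have "sets (stream_space (measure_pmf p)) = sets (stream_space (count_space UNIV))"
    by (intro sets_stream_space_cong) simp
  then show ?thesis
    by (subst measurable_cong_sets[OF _ refl]) measurable
qed

text \<open>The first \<open>l\<close> letters are independent of the remaining stream, which has
  law \<open>S\<close> again. In the induction \<open>f\<close> has to vary because a letter
  \<open>x\<close> that has been split off stays inside it, as \<open>f (x # _)\<close>.\<close>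

lemma nn_integral_stake_sdrop:
  fixes p :: "'a::countable pmf" and f :: "'a list \<Rightarrow> ennreal"
  defines "S \<equiv> stream_space (measure_pmf p)"
  assumes h [measurable]: "h \<in> borel_measurable S"
  shows "(\<integral>\<^sup>+\<omega>. f (stake l \<omega>) * h (sdrop l \<omega>) \<partial>S) = (\<integral>\<^sup>+\<omega>. f (stake l \<omega>) \<partial>S) * (\<integral>\<^sup>+\<omega>. h \<omega> \<partial>S)"
proof (induction l arbitrary: f)
  case 0
  interpret P: prob_space S unfolding S_def by (rule prob_space.prob_space_stream_space[OF prob_space_measure_pmf])
  show ?case by (simp add: nn_integral_cmult P.emeasure_space_1)
next
  case (Suc l)
  have [measurable]: "stake l \<in> measurable S (count_space UNIV)" for l
    unfolding S_def by (rule measurable_stake_pmf)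
  have m [measurable]: "(\<lambda>\<omega>. g (stake l \<omega>)) \<in> borel_measurable S" for g :: "'a list \<Rightarrow> ennreal" and l
    by measurable
  have h' [measurable]: "(\<lambda>\<omega>. h (sdrop l \<omega>)) \<in> borel_measurable S" for l
    using h unfolding S_def by measurable
  have m' [measurable]: "(\<lambda>\<omega>. f (stake (Suc l) \<omega>) * h (sdrop (Suc l) \<omega>)) \<in> borel_measurable S"
    using m[of f "Suc l"] h'[of "Suc l"] by (rule borel_measurable_times_ennreal)
  have eq: "(\<integral>\<^sup>+\<omega>. g \<omega> \<partial>S) = (\<integral>\<^sup>+x. (\<integral>\<^sup>+\<omega>. g (x ## \<omega>) \<partial>S) \<partial>measure_pmf p)"
    if "g \<in> borel_measurable S" for g
    using that unfolding S_def by (rule prob_space.nn_integral_stream_space[OF prob_space_measure_pmf])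
  have "(\<integral>\<^sup>+\<omega>. f (stake (Suc l) \<omega>) * h (sdrop (Suc l) \<omega>) \<partial>S)
      = (\<integral>\<^sup>+x. (\<integral>\<^sup>+\<omega>. f (x # stake l \<omega>) * h (sdrop l \<omega>) \<partial>S) \<partial>measure_pmf p)"
    by (subst eq[OF m']) simp
  also have "\<dots> = (\<integral>\<^sup>+x. (\<integral>\<^sup>+\<omega>. f (x # stake l \<omega>) \<partial>S) * (\<integral>\<^sup>+\<omega>. h \<omega> \<partial>S) \<partial>measure_pmf p)"
    by (subst Suc) simp
  also have "\<dots> = (\<integral>\<^sup>+x. (\<integral>\<^sup>+\<omega>. f (x # stake l \<omega>) \<partial>S) \<partial>measure_pmf p) * (\<integral>\<^sup>+\<omega>. h \<omega> \<partial>S)"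
    by (simp add: nn_integral_multc)
  also have "(\<integral>\<^sup>+x. (\<integral>\<^sup>+\<omega>. f (x # stake l \<omega>) \<partial>S) \<partial>measure_pmf p) = (\<integral>\<^sup>+\<omega>. f (stake (Suc l) \<omega>) \<partial>S)"
    using eq[OF m[of f "Suc l"]] by simp
  finally show ?case .
qed

text \<open>Consecutive disjoint blocks are i.i.d.; the product form is the one that factorises
  exponential moments.\<close>

lemma nn_integral_block_prod:
  fixes p :: "'a::countable pmf" and f :: "'a list \<Rightarrow> ennreal"
  defines "S \<equiv> stream_space (measure_pmf p)"
  shows "(\<integral>\<^sup>+\<omega>. (\<Prod>t<n. f (stake l (sdrop (t * l) \<omega>))) \<partial>S) = (\<integral>\<^sup>+\<omega>. f (stake l \<omega>) \<partial>S) ^ n"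
proof (induction n)
  case 0
  interpret P: prob_space S unfolding S_def by (rule prob_space.prob_space_stream_space[OF prob_space_measure_pmf])
  show ?case by (simp add: P.emeasure_space_1)
next
  case (Suc n)
  have [measurable]: "stake l \<in> measurable S (count_space UNIV)" for l
    unfolding S_def by (rule measurable_stake_pmf)
  have m: "(\<lambda>\<omega>. f (stake l \<omega>)) \<in> borel_measurable S" for l
    by measurable
  have "(\<lambda>\<omega>. f (stake l (sdrop k \<omega>))) \<in> borel_measurable S" for k
    by (rule measurable_compose[OF _ m]) (simp add: S_def)
  then have [measurable]: "(\<lambda>\<omega>. \<Prod>t<n. f (stake l (sdrop (t * l) \<omega>))) \<in> borel_measurable S"
    by measurable
  have "(\<integral>\<^sup>+\<omega>. (\<Prod>t<Suc n. f (stake l (sdrop (t * l) \<omega>))) \<partial>S)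
     = (\<integral>\<^sup>+\<omega>. f (stake l \<omega>) * (\<Prod>t<n. f (stake l (sdrop (t * l) (sdrop l \<omega>)))) \<partial>S)"
    by (simp add: prod.lessThan_Suc_shift sdrop_add add.commute del: prod.lessThan_Suc)
  also have "\<dots> = (\<integral>\<^sup>+\<omega>. f (stake l \<omega>) \<partial>S) * (\<integral>\<^sup>+\<omega>. (\<Prod>t<n. f (stake l (sdrop (t * l) \<omega>))) \<partial>S)"
    unfolding S_def by (rule nn_integral_stake_sdrop) (fold S_def, measurable)
  finally show ?case by (simp add: Suc)
qed


text \<open>A Chernoff bound: the range of \<open>g\<close> has length 1, so Hoeffding's lemma
  bounds the exponential moment of one block by \<open>exp (s\<^sup>2 / 8)\<close>, and the blocks
  multiply.\<close>

lemma block_sum_tail: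
  fixes p :: "'a::countable pmf" and g :: "'a list \<Rightarrow> real"
  defines "S \<equiv> stream_space (measure_pmf p)"
  assumes g: "\<And>w. g w \<in> {a..a + 1}" and mean: "(\<integral>\<omega>. g (stake l \<omega>) \<partial>S) = 0" and "\<epsilon> > 0"
  shows "measure S {\<omega> \<in> space S. (\<Sum>t<n. g (stake l (sdrop (t * l) \<omega>))) \<ge> \<epsilon> * real n}
     \<le> exp (- 2 * \<epsilon>\<^sup>2) ^ n" (is "measure S ?B \<le> _")
proof -
  interpret P: prob_space S
    unfolding S_def by (rule prob_space.prob_space_stream_space[OF prob_space_measure_pmf])
  have [measurable]: "stake l \<in> measurable S (count_space UNIV)" for l
    unfolding S_def by (rule measurable_stake_pmf)
  have [measurable]: "sdrop k \<in> measurable S S" for k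
    by (simp add: S_def)
  interpret interval_bounded_random_variable S "\<lambda>\<omega>. g (stake l \<omega>)" a "a + 1"
    by unfold_locales (use g in auto)
  \<comment> \<open>This value minimises \<open>s\<^sup>2 / 8 - s * \<epsilon>\<close>; the minimum
    is \<open>- 2 * \<epsilon>\<^sup>2\<close>.\<close>
  define s where "s = 4 * \<epsilon>"
  have "s > 0"
    using \<open>\<epsilon> > 0\<close> by (simp add: s_def)
  have mgf: "(\<integral>\<^sup>+\<omega>. ennreal (exp (s * g (stake l \<omega>))) \<partial>S) \<le> ennreal (exp (s\<^sup>2 / 8))"
    using Hoeffdings_lemma_nn_integral_0[OF \<open>s > 0\<close> mean] by simp
  define Y where "Y \<omega> = (\<Sum>t<n. g (stake l (sdrop (t * l) \<omega>)))" for \<omega>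
  have [measurable]: "Y \<in> borel_measurable S"
    unfolding Y_def by measurable
  have "(\<integral>\<^sup>+\<omega>. ennreal (exp (s * Y \<omega>)) \<partial>S)
      = (\<integral>\<^sup>+\<omega>. (\<Prod>t<n. ennreal (exp (s * g (stake l (sdrop (t * l) \<omega>))))) \<partial>S)"
    by (simp add: Y_def sum_distrib_left exp_sum prod_ennreal)
  also have "\<dots> = (\<integral>\<^sup>+\<omega>. ennreal (exp (s * g (stake l \<omega>))) \<partial>S) ^ n"
    unfolding S_def by (rule nn_integral_block_prod)
  also have "\<dots> \<le> ennreal (exp (s\<^sup>2 / 8)) ^ n"
    by (rule power_mono[OF mgf]) simp
  finally have E: "(\<integral>\<^sup>+\<omega>. ennreal (exp (s * Y \<omega>)) \<partial>S) \<le> ennreal (exp (s\<^sup>2 / 8) ^ n)"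
    by (simp add: ennreal_power)
  have "emeasure S ?B = (\<integral>\<^sup>+\<omega>. indicator ?B \<omega> \<partial>S)"
    by (subst nn_integral_indicator) (auto simp flip: Y_def)
  also have "\<dots> \<le> (\<integral>\<^sup>+\<omega>. ennreal (exp (- s * \<epsilon>) ^ n) * ennreal (exp (s * Y \<omega>)) \<partial>S)"
  proof (rule nn_integral_mono)
    fix \<omega>
    have "1 \<le> exp (- s * \<epsilon>) ^ n * exp (s * Y \<omega>)" if "\<omega> \<in> ?B"
    proof -
      have "0 \<le> s * (Y \<omega> - \<epsilon> * real n)"
        using that \<open>s > 0\<close> by (simp flip: Y_def)
      then have "1 \<le> exp (s * (Y \<omega> - \<epsilon> * real n))"
        by simp
      also have "\<dots> = exp (- s * \<epsilon>) ^ n * exp (s * Y \<omega>)"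
        by (simp add: algebra_simps flip: exp_add exp_of_nat_mult)
      finally show ?thesis .
    qed
    then show "indicator ?B \<omega> \<le> ennreal (exp (- s * \<epsilon>) ^ n) * ennreal (exp (s * Y \<omega>))"
      by (auto simp: indicator_def ennreal_1[symmetric] simp flip: ennreal_mult simp del: ennreal_1)
  qed
  also have "\<dots> = ennreal (exp (- s * \<epsilon>) ^ n) * (\<integral>\<^sup>+\<omega>. ennreal (exp (s * Y \<omega>)) \<partial>S)"
    by (rule nn_integral_cmult) measurable
  also have "\<dots> \<le> ennreal (exp (- s * \<epsilon>) ^ n) * ennreal (exp (s\<^sup>2 / 8) ^ n)"
    by (rule mult_left_mono[OF E]) simp
  also have "\<dots> = ennreal ((exp (- s * \<epsilon>) * exp (s\<^sup>2 / 8)) ^ n)"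
    by (simp add: power_mult_distrib flip: ennreal_mult)
  also have "exp (- s * \<epsilon>) * exp (s\<^sup>2 / 8) = exp (- 2 * \<epsilon>\<^sup>2)"
    by (simp add: s_def power2_eq_square flip: exp_add)
  finally show ?thesis
    by (simp add: P.emeasure_eq_measure)
qed

text \<open>A strong law of large numbers. The exponential tails are summable, so Borel--Cantelli
  applies to each tolerance and each sign of the deviation; the tolerances \<open>1 / Suc m\<close>
  are countably many, so one null set serves them all.\<close>

lemma block_frequency:
  fixes p :: "'a::countable pmf" and A :: "'a list set"
  defines "S \<equiv> stream_space (measure_pmf p)"
  shows "AE \<omega> in S. (\<lambda>n. real (card {t. t < n \<and> stake l (sdrop (t * l) \<omega>) \<in> A}) / real n)
           \<longlonglongrightarrow> measure S {\<omega> \<in> space S. stake l \<omega> \<in> A}"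
proof -
  interpret P: prob_space S
    unfolding S_def by (rule prob_space.prob_space_stream_space[OF prob_space_measure_pmf])
  have [measurable]: "stake l \<in> measurable S (count_space UNIV)" for l
    unfolding S_def by (rule measurable_stake_pmf)
  have [measurable]: "sdrop k \<in> measurable S S" for k
    by (simp add: S_def)
  define q where "q = measure S {\<omega> \<in> space S. stake l \<omega> \<in> A}"
  define X where "X t \<omega> = (indicator A (stake l (sdrop (t * l) \<omega>)) :: real)" for t \<omega>
  have int: "(\<integral>\<omega>. indicator A (stake l \<omega>) \<partial>S) = q"
  proof -
    have "(\<integral>\<omega>. indicator A (stake l \<omega>) \<partial>S) = (\<integral>\<omega>. indicat_real {\<omega> \<in> space S. stake l \<omega> \<in> A} \<omega> \<partial>S)"
      by (intro Bochner_Integration.integral_cong) (auto simp: indicator_def)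
    then show ?thesis by (simp add: q_def)
  qed
  have integrable: "integrable S (\<lambda>\<omega>. indicator A (stake l \<omega>) :: real)"
    by (rule P.integrable_const_bound[where B = 1]) auto
  have "AE \<omega> in S. \<forall>\<^sub>F n in sequentially. \<bar>(\<Sum>t<n. X t \<omega>) / real n - q\<bar> < 1 / real (Suc m)" for m
  proof -
    define \<epsilon> where "\<epsilon> = 1 / real (Suc m)"
    have \<epsilon>: "\<epsilon> > 0" by (simp add: \<epsilon>_def)
    have *: "AE \<omega> in S. \<forall>\<^sub>F n in sequentially. (\<Sum>t<n. c * (X t \<omega> - q)) < \<epsilon> * real n"
      if c: "c = 1 \<or> c = - 1" for c
    proof -
      define B where "B n = {\<omega> \<in> space S. (\<Sum>t<n. c * (X t \<omega> - q)) \<ge> \<epsilon> * real n}" for n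
      have "AE \<omega> in S. \<forall>\<^sub>F n in sequentially. \<omega> \<in> space S - B n"
      proof (rule borel_cantelli_AE1)
        show "B n \<in> sets S" for n
          unfolding B_def X_def by measurable
        show "summable (\<lambda>n. measure S (B n))"
        proof (rule summable_comparison_test')
          show "summable (\<lambda>n. exp (- 2 * \<epsilon>\<^sup>2) ^ n)"
            using \<epsilon> by (intro summable_geometric) simp
          fix n :: nat
          define a where "a = (if c = 1 then - q else q - 1)"
          have "measure S (B n) \<le> exp (- 2 * \<epsilon>\<^sup>2) ^ n"
            unfolding B_def X_def S_def
          proof (rule block_sum_tail[where a = a, OF _ _ \<epsilon>])
            show "c * (indicator A w - q) \<in> {a..a + 1}" for w
              using c by (auto simp: a_def indicator_def)
            show "(\<integral>\<omega>. c * (indicator A (stake l \<omega>) - q) \<partial>stream_space (measure_pmf p)) = 0"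
              unfolding S_def[symmetric] using integrable by (simp add: int P.prob_space)
          qed
          then show "norm (measure S (B n)) \<le> exp (- 2 * \<epsilon>\<^sup>2) ^ n" by simp
        qed
      qed (simp add: less_top[symmetric])
      then show ?thesis
        by eventually_elim (auto simp: B_def not_le elim: eventually_mono)
    qed
    show ?thesis
      using *[OF disjI1[OF refl]] *[OF disjI2[OF refl]]
    proof eventually_elim
      case (elim \<omega>)
      then show ?case
        using eventually_gt_at_top[of 0]
      proof eventually_elim
        case (elim n)
        then have "\<bar>(\<Sum>t<n. X t \<omega>) - q * real n\<bar> < \<epsilon> * real n"
          by (auto simp: sum_subtractf sum_negf algebra_simps abs_less_iff)
        then have "\<bar>((\<Sum>t<n. X t \<omega>) - q * real n) / real n\<bar> < \<epsilon>"
          using \<open>0 < n\<close> by (simp add: abs_divide divide_less_eq)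
        then show ?case
          using \<open>0 < n\<close> by (simp add: \<epsilon>_def diff_divide_distrib)
      qed
    qed
  qed
  then have "AE \<omega> in S. \<forall>m. \<forall>\<^sub>F n in sequentially. \<bar>(\<Sum>t<n. X t \<omega>) / real n - q\<bar> < 1 / real (Suc m)"
    unfolding AE_all_countable by blast
  then show ?thesis
  proof eventually_elim
    case (elim \<omega>)
    have "(\<lambda>n. (\<Sum>t<n. X t \<omega>) / real n) \<longlonglongrightarrow> q"
    proof (rule tendstoI)
      fix e :: real assume "e > 0"
      then obtain m where "1 / real (Suc m) < e"
        using nat_approx_posE by (metis inverse_eq_divide)
      then show "\<forall>\<^sub>F n in sequentially. dist ((\<Sum>t<n. X t \<omega>) / real n) q < e"
        using elim[rule_format, of m] by (auto simp: dist_real_def elim: eventually_mono)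
    qed
    moreover have "(\<Sum>t<n. X t \<omega>) = real (card {t. t < n \<and> stake l (sdrop (t * l) \<omega>) \<in> A})" for n
      unfolding X_def indicator_def by (simp add: of_bool_def sum.If_cases Int_def)
    ultimately show ?case by (simp add: q_def)
  qed
qed

lemma stake_eq_pos:
  fixes p :: "'a::countable pmf"
  defines "S \<equiv> stream_space (measure_pmf p)"
  assumes "set w \<subseteq> set_pmf p"
  shows "0 < (\<integral>\<^sup>+\<omega>. indicator {w} (stake (length w) \<omega>) \<partial>S)"
  using assms(2)
proof (induction w)
  case Nil
  interpret P: prob_space S
    unfolding S_def by (rule prob_space.prob_space_stream_space[OF prob_space_measure_pmf])
  show ?case by (simp add: P.emeasure_space_1)
next
  case (Cons e w)
  have [measurable]: "stake l \<in> measurable S (count_space UNIV)" for l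
    unfolding S_def by (rule measurable_stake_pmf)
  have m: "(\<lambda>\<omega>. indicator {v} (stake n \<omega>) :: ennreal) \<in> borel_measurable S" for v :: "'a list" and n
    by measurable
  let ?c = "\<integral>\<^sup>+\<omega>. indicator {w} (stake (length w) \<omega>) \<partial>S"
  have "(\<integral>\<^sup>+\<omega>. indicator {e # w} (stake (length (e # w)) \<omega>) \<partial>S)
      = (\<integral>\<^sup>+x. (\<integral>\<^sup>+\<omega>. indicator {e # w} (stake (length (e # w)) (x ## \<omega>)) \<partial>S) \<partial>measure_pmf p)"
    using m unfolding S_def by (rule prob_space.nn_integral_stream_space[OF prob_space_measure_pmf])
  also have "\<dots> = (\<integral>\<^sup>+x. (\<integral>\<^sup>+\<omega>. indicator {e} x * indicator {w} (stake (length w) \<omega>) \<partial>S) \<partial>measure_pmf p)"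
    by (intro nn_integral_cong) (auto simp: indicator_def)
  also have "\<dots> = (\<integral>\<^sup>+x. indicator {e} x * ?c \<partial>measure_pmf p)"
    by (intro nn_integral_cong nn_integral_cmult m)
  also have "\<dots> = ennreal (pmf p e) * ?c"
    by (simp add: nn_integral_multc emeasure_pmf_single)
  finally show ?case
    using Cons by (simp add: ennreal_zero_less_mult_iff pmf_positive_iff)
qed

text \<open>The word \<open>w\<close> only witnesses that the event \<open>A\<close> has positive
  probability. This covers a single word (\<open>A = {w}\<close>) as well as, with blocks of length
  1, the participation of a given player.\<close>

lemma block_frequency_pos:
  fixes p :: "'a::countable pmf" and A :: "'a list set"
  assumes "w \<in> A" "set w \<subseteq> set_pmf p"
  shows "AE \<omega> in stream_space (measure_pmf p). \<exists>q>0.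
    (\<lambda>n. real (card {t. t < n \<and> stake (length w) (sdrop (t * length w) \<omega>) \<in> A}) / real n) \<longlonglongrightarrow> q"
proof -
  define S where "S = stream_space (measure_pmf p)"
  interpret P: prob_space S
    unfolding S_def by (rule prob_space.prob_space_stream_space[OF prob_space_measure_pmf])
  have [measurable]: "stake l \<in> measurable S (count_space UNIV)" for l
    unfolding S_def by (rule measurable_stake_pmf)
  let ?B = "\<lambda>A. {\<omega> \<in> space S. stake (length w) \<omega> \<in> A}"
  have "(\<integral>\<^sup>+\<omega>. indicator {w} (stake (length w) \<omega>) \<partial>S) = (\<integral>\<^sup>+\<omega>. indicator (?B {w}) \<omega> \<partial>S)"
    by (intro nn_integral_cong) (auto simp: indicator_def)
  also have "\<dots> = ennreal (measure S (?B {w}))"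
    by (simp add: P.emeasure_eq_measure)
  finally have "0 < measure S (?B {w})"
    using stake_eq_pos[OF assms(2)] by (simp add: S_def)
  also have "\<dots> \<le> measure S (?B A)"
    using assms(1) by (intro P.finite_measure_mono) auto
  finally have "0 < measure S (?B A)" .
  then show ?thesis
    using block_frequency[of "length w" A p] unfolding S_def by (auto elim!: eventually_mono)
qed

section \<open>Recursive inequalities for real sequences\<close>

text \<open>Far from 0, \<open>U\<close> drops by at least \<open>\<eta> / 2 * \<gamma> k\<close>,
  which cannot go on forever because the sum of \<gamma> diverges. Once \<open>U\<close> is below
  \<open>2 * \<delta>\<close>, a single step climbs by at most \<delta>, and above
  \<open>2 * \<delta>\<close> it only descends, so it never exceeds \<open>3 * \<delta>\<close>
  again.\<close>

lemma perturbed_descent_tendsto_0: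
  fixes U V \<phi> \<epsilon> \<gamma> :: "nat \<Rightarrow> real"
  assumes V: "\<And>k. V k \<ge> 0" and UV: "(\<lambda>k. U k - V k) \<longlonglongrightarrow> 0"
    and step: "\<And>k. U (Suc k) \<le> U k - \<gamma> k * (\<phi> k - \<epsilon> k)"
    and \<gamma>: "\<And>k. 0 \<le> \<gamma> k" "\<And>k. \<gamma> k \<le> 1" "\<not> summable \<gamma>"
    and \<phi>: "\<And>k. \<phi> k \<ge> 0"
    and \<phi>_pos: "\<And>\<delta>. \<delta> > 0 \<Longrightarrow> \<exists>\<eta>>0. \<forall>k. V k \<ge> \<delta> \<longrightarrow> \<phi> k \<ge> \<eta>"
    and \<epsilon>: "\<epsilon> \<longlonglongrightarrow> 0"
  shows "V \<longlonglongrightarrow> 0"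
proof (rule LIMSEQ_I)
  fix e :: real assume "e > 0"
  \<comment> \<open>The argument ends with
    \<open>V < U + \<delta> \<le> 4 * \<delta> = e / 2\<close>.\<close>
  define \<delta> where "\<delta> = e / 8"
  have \<delta>: "\<delta> > 0" using \<open>e > 0\<close> by (simp add: \<delta>_def)
  obtain \<eta> where \<eta>: "\<eta> > 0" "\<And>k. V k \<ge> \<delta> \<Longrightarrow> \<phi> k \<ge> \<eta>"
    using \<phi>_pos[OF \<delta>] by blast
  have "\<forall>\<^sub>F k in sequentially. \<bar>U k - V k\<bar> < \<delta> \<and> \<bar>\<epsilon> k\<bar> < min (\<eta> / 2) \<delta>"
    using tendstoD[OF UV \<delta>] tendstoD[OF \<epsilon>, of "min (\<eta> / 2) \<delta>"] \<eta>(1) \<delta>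
    by (auto simp: dist_real_def eventually_conj_iff)
  then obtain K where K: "\<And>k. k \<ge> K \<Longrightarrow> \<bar>U k - V k\<bar> < \<delta>" "\<And>k. k \<ge> K \<Longrightarrow> \<bar>\<epsilon> k\<bar> < min (\<eta> / 2) \<delta>"
    by (auto simp: eventually_sequentially)
  have far: "U (Suc k) \<le> U k - \<eta> / 2 * \<gamma> k" if "k \<ge> K" "U k \<ge> 2 * \<delta>" for k
  proof -
    have "V k \<ge> \<delta>" using K(1)[of k] that by linarith
    then have "\<eta> / 2 \<le> \<phi> k - \<epsilon> k" using \<eta>(2)[of k] K(2)[of k] that by linarith
    then have "\<gamma> k * (\<eta> / 2) \<le> \<gamma> k * (\<phi> k - \<epsilon> k)" by (intro mult_left_mono \<gamma>)
    then show ?thesis using step[of k] by (simp add: mult.commute)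
  qed
  have near: "U (Suc k) \<le> 3 * \<delta>" if "k \<ge> K" "U k < 2 * \<delta>" for k
  proof -
    have "- \<delta> \<le> \<phi> k - \<epsilon> k" using \<phi>[of k] K(2)[of k] that by linarith
    then have "\<gamma> k * (- \<delta>) \<le> \<gamma> k * (\<phi> k - \<epsilon> k)" by (intro mult_left_mono \<gamma>)
    moreover have "\<gamma> k * \<delta> \<le> 1 * \<delta>" using \<delta> \<gamma>(2)[of k] by (intro mult_right_mono) auto
    ultimately show ?thesis using step[of k] that by simp
  qed
  have "\<exists>k\<ge>K. U k < 2 * \<delta>"
  proof (rule ccontr)
    assume "\<not> (\<exists>k\<ge>K. U k < 2 * \<delta>)"
    then have all: "U k \<ge> 2 * \<delta>" if "k \<ge> K" for k using that by force
    have sum: "U (n + K) \<le> U K - \<eta> / 2 * (\<Sum>k<n. \<gamma> (k + K))" for n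
    proof (induction n)
      case (Suc n)
      show ?case using far[of "n + K"] all[of "n + K"] Suc by (simp add: algebra_simps)
    qed simp
    have "(\<Sum>k<n. \<gamma> (k + K)) \<le> U K / (\<eta> / 2)" for n
    proof -
      have "\<eta> / 2 * (\<Sum>k<n. \<gamma> (k + K)) \<le> U K" using sum[of n] all[of "n + K"] \<delta> by simp
      then show ?thesis using \<eta>(1) by (simp add: field_simps)
    qed
    then have "summable (\<lambda>k. \<gamma> (k + K))"
      using \<gamma>(1) by (intro summableI_nonneg_bounded) auto
    then show False using \<gamma>(3) by (simp add: summable_iff_shift)
  qed
  then obtain k0 where k0: "k0 \<ge> K" "U k0 < 2 * \<delta>" by blast
  have "U k \<le> 3 * \<delta>" if "k \<ge> k0" for k
    using that
  proof (induction k rule: dec_induct)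
    case base
    then show ?case using k0 \<delta> by simp
  next
    case (step k)
    show ?case
    proof (cases "U k < 2 * \<delta>")
      case False
      have "\<eta> / 2 * \<gamma> k \<ge> 0" using \<eta>(1) \<gamma>(1)[of k] by simp
      then show ?thesis using far[of k] False step k0 by simp
    qed (use near step k0 in simp)
  qed
  then have bound: "U k \<le> 3 * \<delta>" if "k \<ge> k0" for k
    using that by simp
  have "norm (V k - 0) < e" if "k \<ge> k0" for k
  proof -
    have "\<bar>U k - V k\<bar> < \<delta>" using that k0(1) by (intro K(1)) simp
    then have "V k < e" using bound[OF that] \<open>e > 0\<close> unfolding \<delta>_def by linarith
    then show ?thesis using V[of k] by simp
  qed
  then show "\<exists>no. \<forall>k\<ge>no. norm (V k - 0) < e" by blast
qed

text \<open>The drift \<open>C / n\<close> is not summable, so it cannot be added up from the start.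
  Looking back from \<open>n\<close> by only a fraction \<open>1 / m\<close> of the elapsed time,
  one collects drift of at most \<open>2 * C / m\<close>, while the positive density of
  \<open>G\<close> puts a number of contractions proportional to \<open>n\<close> into the same
  window.\<close>

lemma intermittent_contraction_tendsto_0:
  fixes M :: "nat \<Rightarrow> real" and G :: "nat set"
  assumes M: "\<And>n. 0 \<le> M n" "\<And>n. M n \<le> K"
    and step: "\<And>n. M (Suc n) \<le> (if n \<in> G then \<theta> * M n else M n) + C / real (Suc n)"
    and \<theta>: "0 \<le> \<theta>" "\<theta> < 1" and "C \<ge> 0"
    and freq: "(\<lambda>n. real (card {t. t < n \<and> t \<in> G}) / real n) \<longlonglongrightarrow> q" and "q > 0"
  shows "M \<longlonglongrightarrow> 0"
proof (rule LIMSEQ_I)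
  fix e :: real assume "e > 0"
  define g where "g n = card {t. t < n \<and> t \<in> G}" for n
  have g_Suc: "g (Suc n) = (if n \<in> G then Suc (g n) else g n)" for n
  proof -
    have "{t. t < Suc n \<and> t \<in> G} = (if n \<in> G then insert n {t. t < n \<and> t \<in> G} else {t. t < n \<and> t \<in> G})"
      by (auto simp: less_Suc_eq)
    then show ?thesis by (simp add: g_def)
  qed
  have g_mono: "g a \<le> g b" if "a \<le> b" for a b
    unfolding g_def using that by (intro card_mono) auto
  \<comment> \<open>Every drift term after time \<open>a\<close> is bounded by the one at
    \<open>a\<close>, and later contractions of it are ignored, so that the two effects
    separate.\<close>
  have iter: "M n \<le> \<theta> ^ (g n - g a) * M a + C * real (n - a) / real (Suc a)" if "a \<le> n" for a n
    using that
  proof (induction n rule: dec_induct)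
    case (step n)
    let ?c = "C / real (Suc a)"
    have c: "C / real (Suc n) \<le> ?c" using step \<open>C \<ge> 0\<close> by (intro divide_left_mono) auto
    have IH: "M n \<le> \<theta> ^ (g n - g a) * M a + ?c * real (n - a)" using step by simp
    have nn: "?c * real (n - a) \<ge> 0" using \<open>C \<ge> 0\<close> by simp
    have "(if n \<in> G then \<theta> * M n else M n) \<le> \<theta> ^ (g (Suc n) - g a) * M a + ?c * real (n - a)"
    proof (cases "n \<in> G")
      case True
      have "\<theta> * M n \<le> \<theta> * (\<theta> ^ (g n - g a) * M a) + \<theta> * (?c * real (n - a))"
        using mult_left_mono[OF IH \<theta>(1)] by (simp add: distrib_left)
      moreover have "\<theta> * (?c * real (n - a)) \<le> 1 * (?c * real (n - a))"
        using \<theta> nn by (intro mult_right_mono) auto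
      ultimately show ?thesis
        using True g_mono[of a n] step by (simp add: g_Suc Suc_diff_le mult.assoc)
    qed (use IH g_Suc in simp)
    then have "M (Suc n) \<le> \<theta> ^ (g (Suc n) - g a) * M a + (?c * real (n - a) + ?c)"
      using assms(3)[of n] c by linarith
    also have "?c * real (n - a) + ?c = ?c * real (Suc n - a)"
      using step by (simp add: Suc_diff_le distrib_left)
    finally show ?case by simp
  qed simp
  \<comment> \<open>The drift \<open>2 * C / m\<close> of a window must stay below
    \<open>e / 2\<close>; \<open>m \<ge> 2\<close> keeps the start \<open>a\<close> of the window at
    or above \<open>n / 2\<close>.\<close>
  obtain m0 :: nat where m0: "4 * C / e < real m0" using reals_Archimedean2 by blast
  define m where "m = m0 + 2"
  have m: "4 * C / e < real m" "m \<ge> 2" using m0 by (auto simp: m_def)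
  then have Cm: "2 * C / real m < e / 2" using \<open>e > 0\<close> by (simp add: field_simps)
  have "(\<lambda>j. \<theta> ^ j * K) \<longlonglongrightarrow> 0 * K"
    using \<theta> by (intro tendsto_intros LIMSEQ_power_zero) auto
  then have "\<forall>\<^sub>F j in sequentially. \<theta> ^ j * K < e / 2"
    using \<open>e > 0\<close> by (intro order_tendstoD(2)[where y = 0]) auto
  then obtain j0 where j0: "\<And>j. j \<ge> j0 \<Longrightarrow> \<theta> ^ j * K < e / 2"
    by (auto simp: eventually_sequentially)
  \<comment> \<open>A window should contain about \<open>q * n / m\<close> elements of
    \<open>G\<close>. The counts at its two ends are each off by at most \<open>\<eta> * n\<close>,
    together \<open>q * n / (2 * m)\<close>, so about half of these elements is certain.\<close>
  define \<eta> where "\<eta> = q / (4 * real m)"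
  have "\<eta> > 0" using \<open>q > 0\<close> m by (simp add: \<eta>_def)
  obtain k0 where k0: "\<And>n. n \<ge> k0 \<Longrightarrow> \<bar>real (g n) / real n - q\<bar> < \<eta>"
    using tendstoD[OF freq \<open>\<eta> > 0\<close>] by (auto simp: eventually_sequentially dist_real_def g_def)
  have gb: "\<bar>real (g n) - q * real n\<bar> \<le> \<eta> * real n" if "n \<ge> k0" "n > 0" for n
  proof -
    have "real (g n) - q * real n = (real (g n) / real n - q) * real n"
      using that by (simp add: field_simps)
    then have "\<bar>real (g n) - q * real n\<bar> = \<bar>real (g n) / real n - q\<bar> * real n"
      by (simp add: abs_mult)
    then show ?thesis using k0[OF that(1)] by (simp add: mult_right_mono)
  qed
  obtain n0 :: nat where n0: "(real j0 + q) * (2 * real m) / q < real n0" using reals_Archimedean2 by blast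
  have "norm (M n - 0) < e" if n: "n \<ge> max n0 (2 * k0 + 2)" for n
  proof -
    define a where "a = n - n div m"
    have dm: "n div m \<le> n div 2" using m(2) by (intro div_le_mono2) auto
    have a: "a \<le> n" "a \<ge> k0" "a > 0" "real n / 2 \<le> real (Suc a)" "n - a = n div m"
      using dm n unfolding a_def by (auto simp: field_simps)
    have div_lower: "real n / real m - 1 \<le> real (n div m)"
    proof -
      have "n < m + n div m * m" using m by (intro dividend_less_div_times) simp
      then have "real n < real m + real (n div m) * real m"
        by (metis of_nat_add of_nat_less_iff of_nat_mult)
      then show ?thesis using m by (simp add: field_simps)
    qed
    have div_upper: "real (n div m) \<le> real n / real m"
      by (rule of_nat_div_le_of_nat)
    have "real (g n) \<ge> (q - \<eta>) * real n" "real (g a) \<le> (q + \<eta>) * real a"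
      using gb[of n] gb[of a] a n by (auto simp: abs_le_iff algebra_simps)
    then have "real (g n) - real (g a) \<ge> q * (real n - real a) - \<eta> * (real n + real a)"
      by (simp add: algebra_simps)
    moreover have "q * (real n - real a) = q * real (n div m)" using a by (simp add: of_nat_diff[symmetric])
    moreover have "q * (real n / real m - 1) \<le> q * real (n div m)"
      using div_lower \<open>q > 0\<close> by (intro mult_left_mono) auto
    moreover have "\<eta> * (real n + real a) \<le> \<eta> * (2 * real n)"
      using a \<open>\<eta> > 0\<close> by (intro mult_left_mono) auto
    moreover have "q * (real n / real m - 1) - \<eta> * (2 * real n) = q * real n / (2 * real m) - q"
      using m by (simp add: \<eta>_def field_simps)
    moreover have "q * real n / (2 * real m) - q > real j0"
    proof -
      have "(real j0 + q) * (2 * real m) / q < real n" using n0 n by simp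
      then show ?thesis using \<open>q > 0\<close> m(2) by (simp add: field_simps)
    qed
    ultimately have "real j0 < real (g n) - real (g a)" by linarith
    then have "j0 \<le> g n - g a" by linarith
    have "\<theta> ^ (g n - g a) * M a \<le> \<theta> ^ (g n - g a) * K"
      using M \<theta> by (intro mult_left_mono) auto
    also have "\<dots> < e / 2" using j0 \<open>j0 \<le> g n - g a\<close> by blast
    finally have 1: "\<theta> ^ (g n - g a) * M a < e / 2" .
    have "C * real (n - a) / real (Suc a) \<le> C * (real n / real m) / (real n / 2)"
      using a n \<open>C \<ge> 0\<close> div_upper by (intro frac_le mult_left_mono) auto
    also have "\<dots> = 2 * C / real m" using n by simp
    finally show ?thesis using iter[OF a(1)] 1 Cm M(1)[of n] by simp
  qed
  then show "\<exists>no. \<forall>n\<ge>no. norm (M n - 0) < e" by blast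
qed

text \<open>The steps \<open>1 / \<nu>\<close> taken at the times in \<open>U\<close> add up to the harmonic number \<open>harm (\<nu> k)\<close> exactly.\<close>
lemma convergent_update_noise:
  fixes U :: "nat set"
  defines "\<nu> \<equiv> \<lambda>k. card {t. t < k \<and> t \<in> U}"
  assumes freq: "(\<lambda>k. real (\<nu> k) / real k) \<longlonglongrightarrow> p" and "p > 0"
  shows "convergent (\<lambda>k. \<Sum>s<k. (if s \<in> U then 1 / real (\<nu> (Suc s)) else 0) - 1 / real (Suc s))"
proof -
  have \<nu>_Suc: "\<nu> (Suc k) = (if k \<in> U then Suc (\<nu> k) else \<nu> k)" for k
  proof -
    have "{t. t < Suc k \<and> t \<in> U} = (if k \<in> U then insert k {t. t < k \<and> t \<in> U} else {t. t < k \<and> t \<in> U})"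
      by (auto simp: less_Suc_eq)
    then show ?thesis by (simp add: \<nu>_def)
  qed
  have \<nu>_0: "\<nu> 0 = 0" by (simp add: \<nu>_def)
  have "(\<Sum>s<k. if s \<in> U then 1 / real (\<nu> (Suc s)) else 0) = harm (\<nu> k)" for k
    by (induction k) (auto simp: \<nu>_Suc harm_Suc inverse_eq_divide harm_expand \<nu>_0)
  moreover have "(\<Sum>s<k. 1 / real (Suc s)) = harm k" for k
    by (induction k) (auto simp: harm_Suc inverse_eq_divide harm_expand)
  ultimately have eq: "(\<Sum>s<k. (if s \<in> U then 1 / real (\<nu> (Suc s)) else 0) - 1 / real (Suc s))
      = harm (\<nu> k) - harm k" for k
    by (simp only: sum_subtractf)
  have ev: "\<forall>\<^sub>F k in sequentially. p / 2 < real (\<nu> k) / real k"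
    using order_tendstoD(1)[OF freq, of "p / 2"] \<open>p > 0\<close> by simp
  have inf: "filterlim \<nu> at_top sequentially"
  proof -
    have "filterlim (\<lambda>k. real (\<nu> k)) at_top sequentially"
    proof (rule filterlim_at_top_mono)
      show "filterlim (\<lambda>k. p / 2 * real k) at_top sequentially"
        using \<open>p > 0\<close> by (intro filterlim_tendsto_pos_mult_at_top[OF tendsto_const] filterlim_real_sequentially) auto
      show "\<forall>\<^sub>F k in sequentially. p / 2 * real k \<le> real (\<nu> k)"
        using ev eventually_gt_at_top[of 0] by eventually_elim (auto simp: field_simps)
    qed
    then show ?thesis
      unfolding filterlim_at_top by (metis (mono_tags, lifting) eventually_mono of_nat_le_iff)
  qed
  \<comment> \<open>Both harmonic numbers are logarithms plus the same constant in the limit, so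
    their difference tends to \<open>ln p\<close>; for \<open>harm (\<nu> k)\<close> this relies on
    \<nu> tending to infinity.\<close>
  have "(\<lambda>k. (harm (\<nu> k) - ln (real (\<nu> k))) - (harm k - ln (real k)) + ln (real (\<nu> k) / real k))
      \<longlonglongrightarrow> euler_mascheroni - euler_mascheroni + ln p"
    using \<open>p > 0\<close>
    by (intro tendsto_intros filterlim_compose[OF euler_mascheroni_LIMSEQ inf] euler_mascheroni_LIMSEQ freq) auto
  moreover have "\<forall>\<^sub>F k in sequentially. (harm (\<nu> k) - ln (real (\<nu> k))) - (harm k - ln (real k))
      + ln (real (\<nu> k) / real k) = harm (\<nu> k) - harm k"
    using ev eventually_gt_at_top[of 0]
  proof eventually_elim
    case (elim k)
    then have "\<nu> k > 0" using \<open>p > 0\<close> by (cases "\<nu> k") auto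
    then show ?case using elim by (simp add: ln_div)
  qed
  ultimately have "(\<lambda>k. harm (\<nu> k) - harm k) \<longlonglongrightarrow> euler_mascheroni - euler_mascheroni + ln p"
    by (simp add: tendsto_cong)
  then show ?thesis unfolding eq by (rule convergentI)
qed

section \<open>Gossip matrices\<close>

lemma nbrs_subset: "simple_graph V E \<Longrightarrow> nbrs E i \<subseteq> V"
  by (auto simp: simple_graph_def nbrs_def)

lemma not_in_nbrs: "simple_graph V E \<Longrightarrow> i \<notin> nbrs E i"
  by (auto simp: simple_graph_def nbrs_def)

lemma cnbrs_subset: "simple_graph V E \<Longrightarrow> i \<in> V \<Longrightarrow> cnbrs E i \<subseteq> V"
  using nbrs_subset by (auto simp: cnbrs_def)

lemma cnbrs_sym: "simple_graph V E \<Longrightarrow> j \<in> cnbrs E i \<longleftrightarrow> i \<in> cnbrs E j"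
  by (auto simp: simple_graph_def cnbrs_def nbrs_def sym_def)

text \<open>The effect of \<open>Wmat\<close> in terms of pairs instead of positions. Only the
  closed neighbourhood of the partner is tested, as an entry \<open>(i, j)\<close> of the state has
  \<open>j \<in> cnbrs E i\<close> anyway.\<close>

definition gossip_avg :: "(nat \<times> nat) set \<Rightarrow> nat \<Rightarrow> nat \<Rightarrow> (nat \<Rightarrow> nat \<Rightarrow> real) \<Rightarrow> nat \<Rightarrow> nat \<Rightarrow> real" where
  "gossip_avg E a b y i j =
     (if i = a \<and> j \<in> cnbrs E b \<or> i = b \<and> j \<in> cnbrs E a then (y a j + y b j) / 2 else y i j)"

context
  fixes N :: nat and E :: "(nat \<times> nat) set"
  assumes G: "simple_graph {1..N} E"
begin

section \<open>Positions of the estimates in the state vector\<close>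

lemma finite_nbrs: "finite (nbrs E i)"
  using nbrs_subset[OF G] by (rule finite_subset) simp

lemma finite_cnbrs: "finite (cnbrs E i)"
  using finite_nbrs by (simp add: cnbrs_def)

lemma mdeg_eq_card_cnbrs: "mdeg E i = card (cnbrs E i)"
  using finite_nbrs not_in_nbrs[OF G] by (simp add: mdeg_def cnbrs_def)

lemma sidx_eq_card: "sidx E i j = card (cnbrs E i \<inter> {1..j}) + (\<Sum>r\<in>{1..<i}. mdeg E r)"
proof -
  have "{1..j} \<inter> {l. (i, l) \<in> E \<or> i = l} = cnbrs E i \<inter> {1..j}"
    by (auto simp: cnbrs_def nbrs_def)
  then have "(\<Sum>l\<in>{1..j}. Bmat E i l) = card (cnbrs E i \<inter> {1..j})"
    by (simp add: Bmat_def sum.If_cases)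
  then show ?thesis by (simp add: sidx_def)
qed

lemma sidx_bounds:
  assumes "i \<in> {1..N}" "j \<in> cnbrs E i"
  shows "(\<Sum>r\<in>{1..<i}. mdeg E r) < sidx E i j" "sidx E i j \<le> (\<Sum>r\<in>{1..<Suc i}. mdeg E r)"
proof -
  have "j \<in> cnbrs E i \<inter> {1..j}"
    using assms cnbrs_subset[OF G assms(1)] by auto
  then have "card (cnbrs E i \<inter> {1..j}) > 0"
    using finite_cnbrs by (auto simp: card_gt_0_iff)
  then show "(\<Sum>r\<in>{1..<i}. mdeg E r) < sidx E i j" by (simp add: sidx_eq_card)
  have "card (cnbrs E i \<inter> {1..j}) \<le> mdeg E i"
    unfolding mdeg_eq_card_cnbrs by (intro card_mono finite_cnbrs) auto
  then show "sidx E i j \<le> (\<Sum>r\<in>{1..<Suc i}. mdeg E r)"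
    using assms by (simp add: sidx_eq_card)
qed

text \<open>The positions list the pairs lexicographically: each row fills an interval of its own,
  in which the rank grows strictly at every member of the closed neighbourhood. This lets a state
  vector be read as a table of estimates.\<close>

lemma sidx_eq_iff:
  assumes "i \<in> {1..N}" "j \<in> cnbrs E i" "i' \<in> {1..N}" "j' \<in> cnbrs E i'"
  shows "sidx E i j = sidx E i' j' \<longleftrightarrow> i = i' \<and> j = j'"
proof -
  have row: "sidx E i j < sidx E i' j'"
    if "i < i'" "i \<in> {1..N}" "j \<in> cnbrs E i" "i' \<in> {1..N}" "j' \<in> cnbrs E i'" for i j i' j'
  proof -
    have "sidx E i j \<le> (\<Sum>r\<in>{1..<Suc i}. mdeg E r)" using that by (intro sidx_bounds)
    also have "\<dots> \<le> (\<Sum>r\<in>{1..<i'}. mdeg E r)" using that by (intro sum_mono2) auto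
    also have "\<dots> < sidx E i' j'" using that by (intro sidx_bounds)
    finally show ?thesis .
  qed
  have col: "sidx E i j < sidx E i j'" if "j < j'" "i \<in> {1..N}" "j' \<in> cnbrs E i" for i j j'
  proof -
    have "j' \<in> cnbrs E i \<inter> {1..j'}" "j' \<notin> cnbrs E i \<inter> {1..j}"
      using that cnbrs_subset[OF G that(2)] by auto
    moreover have "cnbrs E i \<inter> {1..j} \<subseteq> cnbrs E i \<inter> {1..j'}"
      using that by auto
    ultimately have "cnbrs E i \<inter> {1..j} \<subset> cnbrs E i \<inter> {1..j'}" by blast
    then show ?thesis
      using finite_cnbrs by (simp add: sidx_eq_card psubset_card_mono)
  qed
  show ?thesis
    using row[of i i' j j'] row[of i' i j' j] col[of j j' i] col[of j' j i] assms
    by (metis less_irrefl linorder_neqE_nat)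
qed

lemma sidx_in_range:
  assumes "i \<in> {1..N}" "j \<in> cnbrs E i"
  shows "sidx E i j \<in> {1..mtot N E}"
proof -
  have "(\<Sum>r\<in>{1..<Suc i}. mdeg E r) \<le> mtot N E"
    unfolding mtot_def using assms by (intro sum_mono2) auto
  then show ?thesis using sidx_bounds[OF assms] by auto
qed

text \<open>The rank-one term of \<open>l\<close> moves the two estimates that \<open>a\<close> and
  \<open>b\<close> hold of \<open>l\<close> to their mean. Distinct pairs have distinct positions,
  so at \<open>sidx E i j\<close> the sum over \<open>l\<close> collapses to
  \<open>l = j\<close>.\<close>

lemma Wmat_apply:
  assumes ab: "(a, b) \<in> E" and ij: "i \<in> {1..N}" "j \<in> cnbrs E i"
  shows "(\<Sum>q\<in>{1..mtot N E}. Wmat E a b (sidx E i j) q * xt q) = gossip_avg E a b (\<lambda>i j. xt (sidx E i j)) i j"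
proof -
  have ab': "a \<in> {1..N}" "b \<in> {1..N}" "a \<noteq> b"
    using ab G by (auto simp: simple_graph_def)
  let ?p = "sidx E i j" and ?I = "{1..mtot N E}"
  have Ev: "(\<Sum>q\<in>?I. Evec E c l q * xt q) = xt (sidx E c l)" if "c \<in> {1..N}" "l \<in> cnbrs E c" for c l
  proof -
    have "(\<Sum>q\<in>?I. Evec E c l q * xt q) = (\<Sum>q\<in>?I. if q = sidx E c l then xt q else 0)"
      using that by (intro sum.cong) (auto simp: Evec_def)
    also have "\<dots> = xt (sidx E c l)" using sidx_in_range[OF that] by simp
    finally show ?thesis .
  qed
  have Ep: "Evec E c l ?p = (if c = i \<and> l = j then 1 else 0)" if "c \<in> {1..N}" "l \<in> cnbrs E c" for c l
    using sidx_eq_iff[OF ij that] that by (auto simp: Evec_def)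
  have fin: "finite (ind E a b)" using finite_cnbrs by (simp add: ind_def)
  have "(\<Sum>q\<in>?I. Wmat E a b ?p q * xt q)
      = (\<Sum>q\<in>?I. if q = ?p then xt q else 0)
        - 1/2 * (\<Sum>q\<in>?I. \<Sum>l\<in>ind E a b. (Evec E a l ?p - Evec E b l ?p) * (Evec E a l q * xt q - Evec E b l q * xt q))"
    unfolding Wmat_def sum_distrib_left sum_subtractf[symmetric]
    by (intro sum.cong refl) (auto simp: algebra_simps sum_distrib_left sum_distrib_right)
  also have "(\<Sum>q\<in>?I. if q = ?p then xt q else 0) = xt ?p"
    using sidx_in_range[OF ij] by simp
  also have "(\<Sum>q\<in>?I. \<Sum>l\<in>ind E a b. (Evec E a l ?p - Evec E b l ?p) * (Evec E a l q * xt q - Evec E b l q * xt q))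
      = (\<Sum>l\<in>ind E a b. (Evec E a l ?p - Evec E b l ?p) * (\<Sum>q\<in>?I. Evec E a l q * xt q - Evec E b l q * xt q))"
    by (subst sum.swap) (simp add: sum_distrib_left)
  also have "\<dots> = (\<Sum>l\<in>ind E a b. if l = j then
      (of_bool (a = i) - of_bool (b = i)) * (xt (sidx E a l) - xt (sidx E b l)) else 0)"
    using ab' by (intro sum.cong refl) (auto simp: ind_def Ev Ep sum_subtractf simp del: One_nat_def)
  also have "\<dots> = (if j \<in> ind E a b then
      (of_bool (a = i) - of_bool (b = i)) * (xt (sidx E a j) - xt (sidx E b j)) else 0)"
    using fin by simp
  finally have eq: "(\<Sum>q\<in>?I. Wmat E a b ?p q * xt q) = xt ?p - 1/2 *
      (if j \<in> ind E a b then (of_bool (a = i) - of_bool (b = i)) * (xt (sidx E a j) - xt (sidx E b j)) else 0)" .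
  consider "i = a" | "i = b" | "i \<noteq> a" "i \<noteq> b" by blast
  then show ?thesis
    unfolding eq gossip_avg_def using ab' ij by cases (auto simp: ind_def diff_divide_distrib add_divide_distrib)
qed

lemma gossip_step_neighbour:
  assumes "(a, b) \<in> E" "i \<in> {1..N}" "j \<in> nbrs E i"
  shows "gossip_step N E \<Omega> dJ \<alpha> (a, b) xt (sidx E i j) = gossip_avg E a b (\<lambda>i j. xt (sidx E i j)) i j"
proof -
  have "j \<in> cnbrs E i" "j \<noteq> i" using assms not_in_nbrs[OF G, of i] by (auto simp: cnbrs_def)
  have "sidx E i j \<noteq> sidx E i' i'" if "i' \<in> {1..N}" for i'
  proof -
    have "i' \<in> cnbrs E i'" by (simp add: cnbrs_def)
    then show ?thesis
      using sidx_eq_iff[OF assms(2) \<open>j \<in> cnbrs E i\<close> that] \<open>j \<noteq> i\<close> by blast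
  qed
  then have not_own: "\<not> (\<exists>i'\<in>{1..N}. sidx E i j = sidx E i' i')" by blast
  show ?thesis
    unfolding gossip_step_def Let_def fst_conv snd_conv if_not_P[OF not_own]
    by (rule Wmat_apply[OF assms(1,2) \<open>j \<in> cnbrs E i\<close>])
qed

lemma gossip_step_own:
  assumes "(a, b) \<in> E" "i \<in> {1..N}"
  shows "gossip_step N E \<Omega> dJ \<alpha> (a, b) xt (sidx E i i) =
    (if i \<in> {a, b} then closest_point (\<Omega> i) (xt (sidx E i i) - \<alpha> i * dJ i (xt (sidx E i i))
       (restrict (gossip_avg E a b (\<lambda>i j. xt (sidx E i j)) i) (nbrs E i)))
     else xt (sidx E i i))"
proof -
  have "i \<in> cnbrs E i" for i by (simp add: cnbrs_def)
  then have "i' = i" if "i' \<in> {1..N} \<and> sidx E i i = sidx E i' i'" for i'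
    using that assms sidx_eq_iff[of i i i' i'] by blast
  then have the: "(THE i'. i' \<in> {1..N} \<and> sidx E i i = sidx E i' i') = i"
    using assms(2) by (intro the_equality) blast+
  have own: "\<exists>i'\<in>{1..N}. sidx E i i = sidx E i' i'"
    using assms(2) by blast
  have avg: "restrict (\<lambda>j. \<Sum>q\<in>{1..mtot N E}. Wmat E a b (sidx E i j) q * xt q) (nbrs E i)
      = restrict (gossip_avg E a b (\<lambda>i j. xt (sidx E i j)) i) (nbrs E i)"
    by (intro restrict_ext Wmat_apply assms) (auto simp: cnbrs_def)
  show ?thesis
    unfolding gossip_step_def Let_def fst_conv snd_conv if_P[OF own] the avg ..
qed

end

text \<open>\<open>pmf_of_set\<close> is meaningful only for nonempty finite sets, hence the
  condition on the neighbour sets. Knowing the support gives every word over the edges positive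
  probability.\<close>

lemma set_select_pmf:
  assumes "N \<ge> 1" "simple_graph {1..N} E" "\<And>i. i \<in> {1..N} \<Longrightarrow> nbrs E i \<noteq> {}"
  shows "set_pmf (select_pmf N E) = E"
proof -
  have "set_pmf (select_pmf N E) = (\<Union>i\<in>{1..N}. Pair i ` nbrs E i)"
    using assms finite_nbrs[OF assms(2)] by (simp add: select_pmf_def)
  also have "\<dots> = E"
    using assms(2) by (auto simp: nbrs_def simple_graph_def)
  finally show ?thesis .
qed

section \<open>Consensus on the estimates\<close>

text \<open>A triangle created by adding \<open>(i, j)\<close> uses the new edge exactly once, since
  two new sides would make the third a loop; its other two sides form the path.\<close>

lemma edge_or_path2:
  assumes E: "simple_graph V E" and Em: "max_triangle_free_spanning_subgraph V E Em" and ij: "(i, j) \<in> E"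
  shows "(i, j) \<in> Em \<or> (\<exists>c. (i, c) \<in> Em \<and> (c, j) \<in> Em)"
proof (cases "(i, j) \<in> Em")
  case False
  have Em': "simple_graph V Em" "triangle_free Em"
    using Em by (auto simp: max_triangle_free_spanning_subgraph_def)
  have "\<not> triangle_free (Em \<union> {(i, j), (j, i)})"
    using Em ij False by (auto simp: max_triangle_free_spanning_subgraph_def)
  then obtain x y z where xyz: "(x, y) \<in> Em \<union> {(i, j), (j, i)}" "(y, z) \<in> Em \<union> {(i, j), (j, i)}"
    "(x, z) \<in> Em \<union> {(i, j), (j, i)}"
    unfolding triangle_free_def by blast
  have sym: "(u, v) \<in> Em \<Longrightarrow> (v, u) \<in> Em" and irrefl: "(u, u) \<notin> Em" for u v
    using Em'(1) by (auto simp: simple_graph_def sym_def)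
  have "i \<noteq> j" using E ij by (auto simp: simple_graph_def)
  have new: "(u, v) \<in> Em \<or> u = i \<and> v = j \<or> u = j \<and> v = i" if "(u, v) \<in> Em \<union> {(i, j), (j, i)}" for u v
    using that by auto
  have "\<not> ((x, y) \<in> Em \<and> (y, z) \<in> Em \<and> (x, z) \<in> Em)"
    using Em'(2) unfolding triangle_free_def by blast
  then show ?thesis
    using new[OF xyz(1)] new[OF xyz(2)] new[OF xyz(3)] sym irrefl \<open>i \<noteq> j\<close> by metis
qed auto

text \<open>
  The vertices of \<open>C\<close> that have averaged, directly or through intermediaries, with a vertex
  of \<open>S\<close> when the pairs of the word meet in order.
\<close>
primrec spread :: "nat set \<Rightarrow> nat set \<Rightarrow> (nat \<times> nat) list \<Rightarrow> nat set" where
  "spread C S [] = S"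
| "spread C S (e # w) =
     spread C (if fst e \<in> C \<and> snd e \<in> C \<and> (fst e \<in> S \<or> snd e \<in> S) then S \<union> {fst e, snd e} else S) w"

text \<open>Greedy choice: each pair crosses from the set reached so far to its complement in
  \<open>C\<close>. The crossing pair is required for all \<open>T\<close> above \<open>S\<close>,
  so that the hypothesis is inherited when \<open>S\<close> grows.\<close>

lemma exists_spreading_word:
  assumes "finite C" "S \<subseteq> C"
    and "\<And>T. S \<subseteq> T \<Longrightarrow> T \<subset> C \<Longrightarrow> \<exists>a\<in>T. \<exists>b\<in>C - T. (a, b) \<in> E"
  shows "\<exists>w. set w \<subseteq> E \<and> spread C S w = C"
  using assms(2,3)
proof (induction "card (C - S)" arbitrary: S rule: less_induct)
  case less
  show ?case
  proof (cases "S = C")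
    case True
    then show ?thesis by (intro exI[of _ "[]"]) simp
  next
    case False
    then obtain a b where ab: "a \<in> S" "b \<in> C - S" "(a, b) \<in> E"
      using less.prems(1) less.prems(2)[of S] by blast
    let ?S = "S \<union> {a, b}"
    have "\<exists>w. set w \<subseteq> E \<and> spread C ?S w = C"
    proof (rule less.hyps)
      show "card (C - ?S) < card (C - S)"
        using ab less.prems(1) \<open>finite C\<close> by (intro psubset_card_mono) auto
      show "?S \<subseteq> C" using ab less.prems(1) by auto
      show "\<exists>a\<in>T. \<exists>b\<in>C - T. (a, b) \<in> E" if "?S \<subseteq> T" "T \<subset> C" for T
        using less.prems(2)[of T] that by auto
    qed
    then obtain w where "set w \<subseteq> E" "spread C ?S w = C" by blast
    then show ?thesis
      using ab less.prems(1) by (intro exI[of _ "(a, b) # w"]) auto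
  qed
qed

text \<open>If \<open>i\<close> is not reached yet, either its edge from \<open>j\<close> or one of
  the two edges of a path through \<open>c\<close> crosses the frontier, depending on whether
  \<open>c\<close> is reached. As \<open>c\<close> is adjacent to \<open>j\<close>, the crossing
  pair stays inside the neighbourhood.\<close>

lemma exists_spreading_word_cnbrs:
  assumes G: "simple_graph {1..N} EI" and Em: "max_triangle_free_spanning_subgraph {1..N} EI Em"
    and "Em \<subseteq> EC" and "j \<in> {1..N}"
  shows "\<exists>w. set w \<subseteq> EC \<and> spread (cnbrs EI j) {j} w = cnbrs EI j"
proof (rule exists_spreading_word)
  show "finite (cnbrs EI j)" by (rule finite_cnbrs[OF G])
  show "{j} \<subseteq> cnbrs EI j" by (simp add: cnbrs_def)
  fix T assume T: "{j} \<subseteq> T" "T \<subset> cnbrs EI j"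
  then obtain i where i: "i \<in> cnbrs EI j" "i \<notin> T" by blast
  then have "(j, i) \<in> EI" using T by (auto simp: cnbrs_def nbrs_def)
  then consider "(j, i) \<in> Em" | c where "(j, c) \<in> Em" "(c, i) \<in> Em"
    using edge_or_path2[OF G Em] by blast
  then show "\<exists>a\<in>T. \<exists>b\<in>cnbrs EI j - T. (a, b) \<in> EC"
  proof cases
    case 1
    then show ?thesis using T i \<open>Em \<subseteq> EC\<close> by blast
  next
    case (2 c)
    then have "c \<in> cnbrs EI j"
      using Em by (auto simp: cnbrs_def nbrs_def max_triangle_free_spanning_subgraph_def)
    then show ?thesis using 2 T i \<open>Em \<subseteq> EC\<close> by (cases "c \<in> T") blast+
  qed
qed

text \<open>One meeting as seen by the errors about a single action \<open>j\<close>, with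
  \<open>C\<close> the closed neighbourhood of \<open>j\<close>: nothing is exchanged unless both
  partners hold an estimate of it.\<close>

definition pair_avg :: "nat set \<Rightarrow> nat \<times> nat \<Rightarrow> (nat \<Rightarrow> real) \<Rightarrow> nat \<Rightarrow> real" where
  "pair_avg C ab e i =
     (if fst ab \<in> C \<and> snd ab \<in> C \<and> (i = fst ab \<or> i = snd ab) then (e (fst ab) + e (snd ab)) / 2 else e i)"

text \<open>
  A vertex of the spread set stays below the worst error by the margin \<open>(1 - \<rho>) * M\<close>. Averaging
  with any vertex costs it at most half of this margin and passes the other half on; hence the
  factor \<open>2 ^ length w\<close>.
\<close>
lemma word_contraction:
  fixes e :: "nat \<Rightarrow> nat \<Rightarrow> real"
  assumes step: "\<And>k i. i \<in> C \<Longrightarrow> \<bar>e (Suc k) i\<bar> \<le> \<bar>pair_avg C (\<omega> !! k) (e k) i\<bar> + d k"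
    and "M \<ge> 0" "S \<subseteq> C" "0 \<le> \<rho>" "\<rho> \<le> 1"
    and all: "\<And>i. i \<in> C \<Longrightarrow> \<bar>e k i\<bar> \<le> M + D" and small: "\<And>i. i \<in> S \<Longrightarrow> \<bar>e k i\<bar> \<le> \<rho> * M + D"
    and word: "stake (length w) (sdrop k \<omega>) = w"
  shows "(\<forall>i\<in>C. \<bar>e (k + length w) i\<bar> \<le> M + D + (\<Sum>s<length w. d (k + s))) \<and>
    (\<forall>i\<in>spread C S w. \<bar>e (k + length w) i\<bar> \<le>
       (1 - (1 - \<rho>) / 2 ^ length w) * M + D + (\<Sum>s<length w. d (k + s)))"
  using assms(3-)
proof (induction w arbitrary: k S \<rho> D)
  case Nil
  then show ?case by simp
next
  case (Cons ab w)
  have ab: "ab = \<omega> !! k" and w: "stake (length w) (sdrop (Suc k) \<omega>) = w"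
    using Cons.prems(6) by (auto simp: sdrop_simps)
  define S' where "S' = (if fst ab \<in> C \<and> snd ab \<in> C \<and> (fst ab \<in> S \<or> snd ab \<in> S) then S \<union> {fst ab, snd ab} else S)"
  define \<rho>' where "\<rho>' = (1 + \<rho>) / 2"
  have \<rho>': "\<rho> \<le> \<rho>'" "0 \<le> \<rho>'" "\<rho>' \<le> 1" using Cons.prems(2,3) by (auto simp: \<rho>'_def)
  have mono: "\<rho> * M \<le> \<rho>' * M" "\<rho>' * M \<le> M"
    using \<rho>' \<open>M \<ge> 0\<close> by (auto intro: mult_right_mono mult_left_le_one_le)
  have all': "\<bar>e (Suc k) i\<bar> \<le> M + (D + d k)" if "i \<in> C" for i
    using step[OF that, of k] Cons.prems(4)[OF that] Cons.prems(4)[of "fst ab"] Cons.prems(4)[of "snd ab"]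
      abs_triangle_ineq[of "e k (fst ab)" "e k (snd ab)"]
    by (auto simp: pair_avg_def ab split: if_splits)
  have small': "\<bar>e (Suc k) i\<bar> \<le> \<rho>' * M + (D + d k)" if i: "i \<in> S'" for i
  proof -
    have "i \<in> C" using i Cons.prems(1) by (auto simp: S'_def split: if_splits)
    moreover have "\<bar>pair_avg C ab (e k) i\<bar> \<le> \<rho>' * M + D"
    proof (cases "fst ab \<in> C \<and> snd ab \<in> C \<and> (i = fst ab \<or> i = snd ab)")
      case True
      then have "fst ab \<in> S \<or> snd ab \<in> S" using i by (auto simp: S'_def split: if_splits)
      then have "\<bar>e k (fst ab)\<bar> + \<bar>e k (snd ab)\<bar> \<le> (\<rho> * M + D) + (M + D)"
        using True Cons.prems(4)[of "fst ab"] Cons.prems(4)[of "snd ab"]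
          Cons.prems(5)[of "fst ab"] Cons.prems(5)[of "snd ab"] by auto
      also have "\<dots> = 2 * (\<rho>' * M + D)" by (simp add: \<rho>'_def algebra_simps)
      finally show ?thesis using True by (auto simp: pair_avg_def)
    next
      case False
      then have "i \<in> S" using i by (auto simp: S'_def split: if_splits)
      moreover have "pair_avg C ab (e k) i = e k i" using False by (auto simp: pair_avg_def)
      ultimately show ?thesis using Cons.prems(5)[of i] mono by simp
    qed
    ultimately show ?thesis using step[of i k] by (simp add: ab)
  qed
  have "S' \<subseteq> C" using Cons.prems(1) by (auto simp: S'_def)
  note IH = Cons.IH[OF this \<rho>'(2,3) all' small' w]
  have "(\<Sum>s<length (ab # w). d (k + s)) = d k + (\<Sum>s<length w. d (Suc k + s))"
    by (simp only: length_Cons sum.lessThan_Suc_shift) simp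
  moreover have "(1 - \<rho>') / 2 ^ length w = (1 - \<rho>) / 2 ^ length (ab # w)"
    by (simp add: \<rho>'_def field_simps)
  moreover have "spread C S (ab # w) = spread C S' w" by (simp add: S'_def)
  ultimately show ?case using IH by (simp add: add.assoc)
qed

text \<open>Time is cut into blocks of length \<open>l = length w\<close>, the units in which
  \<open>freq\<close> counts. A block that spells \<open>w\<close> shrinks the worst error by the
  factor \<open>1 - 1 / 2 ^ l\<close>, because the leader enters it with error 0; any other block
  adds at most its drift. This is the situation of
  \<open>intermittent_contraction_tendsto_0\<close>.\<close>

lemma leader_consensus:
  fixes e :: "nat \<Rightarrow> nat \<Rightarrow> real"
  assumes step: "\<And>k i. i \<in> C \<Longrightarrow> \<bar>e (Suc k) i\<bar> \<le> \<bar>pair_avg C (\<omega> !! k) (e k) i\<bar> + d k"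
    and C: "finite C" "j \<in> C" and leader: "\<And>k. e k j = 0"
    and bounded: "\<And>k i. i \<in> C \<Longrightarrow> \<bar>e k i\<bar> \<le> K"
    and d: "\<And>k. 0 \<le> d k" "\<And>k. d k \<le> B / real (Suc k)"
    and w: "w \<noteq> []" "spread C {j} w = C"
    and freq: "(\<lambda>n. real (card {t. t < n \<and> stake (length w) (sdrop (t * length w) \<omega>) = w}) / real n) \<longlonglongrightarrow> q"
    and "q > 0" and i: "i \<in> C"
  shows "(\<lambda>k. e k i) \<longlonglongrightarrow> 0"
proof -
  define M where "M k = Max ((\<lambda>i. \<bar>e k i\<bar>) ` C)" for k
  have M_ge: "\<bar>e k i\<bar> \<le> M k" if "i \<in> C" for k i
    unfolding M_def using that C by (intro Max_ge) auto
  have M_le: "M k \<le> c" if "\<And>i. i \<in> C \<Longrightarrow> \<bar>e k i\<bar> \<le> c" for k c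
    unfolding M_def using that C by (subst Max_le_iff) auto
  have M_nonneg: "0 \<le> M k" for k
    using M_ge[OF C(2), of k] leader by simp
  define l where "l = length w"
  have "l > 0" using w by (simp add: l_def)
  have "B \<ge> 0" using d(1)[of 0] d(2)[of 0] by simp
  define c where "c = real l * B"
  have c: "c \<ge> 0" using \<open>B \<ge> 0\<close> by (simp add: c_def)
  \<comment> \<open>All times in block \<open>n\<close> are at least \<open>n\<close>; this crude
    bound already gives the drift of a block the required form, a constant over
    \<open>n + 1\<close>.\<close>
  have sum_d: "(\<Sum>s<r. d (n * l + s)) \<le> c / real (Suc n)" if "r \<le> l" for n r
  proof -
    have "(\<Sum>s<r. d (n * l + s)) \<le> (\<Sum>s<r. B / real (Suc n))"
    proof (rule sum_mono)
      fix s
      have "Suc n \<le> Suc (n * l + s)" using \<open>l > 0\<close> by (simp add: trans_le_add1)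
      then have "real (Suc n) \<le> real (Suc (n * l + s))" by (rule of_nat_mono)
      then have "B / real (Suc (n * l + s)) \<le> B / real (Suc n)"
        using \<open>B \<ge> 0\<close> by (intro frac_le order_refl) simp_all
      then show "d (n * l + s) \<le> B / real (Suc n)" using d(2)[of "n * l + s"] by linarith
    qed
    also have "\<dots> = real r * (B / real (Suc n))" by simp
    also have "\<dots> \<le> real l * (B / real (Suc n))"
      using that \<open>B \<ge> 0\<close> by (intro mult_right_mono) auto
    finally show ?thesis by (simp add: c_def)
  qed
  have window: "M (n * l + r) \<le> M (n * l) + c / real (Suc n)" if "r \<le> l" for n r
  proof (rule M_le)
    fix i assume "i \<in> C"
    let ?v = "stake r (sdrop (n * l) \<omega>)"
    have "\<forall>i\<in>C. \<bar>e (n * l + length ?v) i\<bar> \<le> M (n * l) + 0 + (\<Sum>s<length ?v. d (n * l + s))"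
    \<comment> \<open>Only the bound on all of \<open>C\<close> is of interest here, for whatever
      word \<open>?v\<close> has occurred; with \<open>S = {}\<close> the smallness condition is
      void.\<close>
    proof (rule word_contraction[where S = "{}" and \<rho> = 0 and \<omega> = \<omega> and C = C, THEN conjunct1])
      show "\<bar>e (Suc k) i\<bar> \<le> \<bar>pair_avg C (\<omega> !! k) (e k) i\<bar> + d k" if "i \<in> C" for k i
        using that by (rule step)
    qed (use M_ge M_nonneg in simp_all)
    with \<open>i \<in> C\<close> have "\<bar>e (n * l + r) i\<bar> \<le> M (n * l) + 0 + (\<Sum>s<r. d (n * l + s))"
      by simp
    then show "\<bar>e (n * l + r) i\<bar> \<le> M (n * l) + c / real (Suc n)"
      using sum_d[OF that, of n] by linarith
  qed
  define G where "G = {t. stake l (sdrop (t * l) \<omega>) = w}"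
  have "(\<lambda>n. M (n * l)) \<longlonglongrightarrow> 0"
  proof (rule intermittent_contraction_tendsto_0[where G = G and \<theta> = "1 - 1 / 2 ^ l" and C = c and q = q])
    show "M (n * l) \<le> K" for n using bounded by (intro M_le) auto
    show "M (Suc n * l) \<le> (if n \<in> G then (1 - 1 / 2 ^ l) * M (n * l) else M (n * l)) + c / real (Suc n)" for n
    proof (cases "n \<in> G")
      case True
      have "M (n * l + l) \<le> (1 - 1 / 2 ^ l) * M (n * l) + c / real (Suc n)"
      proof (rule M_le)
        fix i assume "i \<in> C"
        have "\<forall>i\<in>spread C {j} w. \<bar>e (n * l + length w) i\<bar>
            \<le> (1 - (1 - 0) / 2 ^ length w) * M (n * l) + 0 + (\<Sum>s<length w. d (n * l + s))"
        proof (rule word_contraction[where \<omega> = \<omega>, THEN conjunct2])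
          show "\<bar>e (Suc k) i\<bar> \<le> \<bar>pair_avg C (\<omega> !! k) (e k) i\<bar> + d k" if "i \<in> C" for k i
            using that by (rule step)
          show "stake (length w) (sdrop (n * l) \<omega>) = w"
            using True by (simp add: G_def l_def)
        qed (use M_ge M_nonneg leader C(2) in simp_all)
        with \<open>i \<in> C\<close> have "\<bar>e (n * l + length w) i\<bar>
            \<le> (1 - (1 - 0) / 2 ^ length w) * M (n * l) + 0 + (\<Sum>s<length w. d (n * l + s))"
          unfolding w(2) by blast
        then show "\<bar>e (n * l + l) i\<bar> \<le> (1 - 1 / 2 ^ l) * M (n * l) + c / real (Suc n)"
          using sum_d[of l n] by (simp add: l_def)
      qed
      then show ?thesis using True by (simp add: add.commute)
    qed (use window[of l n] in \<open>simp add: add.commute\<close>)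
    show "(\<lambda>n. real (card {t. t < n \<and> t \<in> G}) / real n) \<longlonglongrightarrow> q"
      using freq by (simp add: G_def l_def)
    show "0 \<le> 1 - 1 / (2::real) ^ l" "1 - 1 / 2 ^ l < (1::real)" by auto
  qed (use M_nonneg c \<open>q > 0\<close> in auto)
  then have "(\<lambda>n. M (n * l) + c / real (Suc n)) \<longlonglongrightarrow> 0 + 0"
    by (intro tendsto_add LIMSEQ_Suc[OF lim_const_over_n])
  then have "(\<lambda>n. M (n * l) + c / real (Suc n)) \<longlonglongrightarrow> 0" by simp
  then have lim: "(\<lambda>k. M (k div l * l) + c / real (Suc (k div l))) \<longlonglongrightarrow> 0"
    by (rule filterlim_compose) (rule filterlim_at_top_div_const_nat[OF \<open>l > 0\<close>])
  show ?thesis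
  proof (rule Lim_null_comparison[OF _ lim])
    have "norm (e k i) \<le> M (k div l * l) + c / real (Suc (k div l))" for k
      using M_ge[OF i, of k] window[of "k mod l" "k div l"] \<open>l > 0\<close> by simp
    then show "\<forall>\<^sub>F k in sequentially. norm (e k i) \<le> M (k div l * l) + c / real (Suc (k div l))"
      by simp
  qed
qed

section \<open>The variational inequality of the game\<close>

text \<open>The point \<open>x\<close> may be an endpoint of \<open>S\<close>, so the derivative
  need not vanish; the difference quotients are taken along the segment towards \<open>z\<close>,
  where minimality fixes their sign.\<close>

lemma first_order_optimality:
  fixes f :: "real \<Rightarrow> real"
  assumes "convex S" "x \<in> S" "z \<in> S"
    and f: "(f has_real_derivative D) (at x within S)" and min: "\<And>y. y \<in> S \<Longrightarrow> f x \<le> f y"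
  shows "0 \<le> D * (z - x)"
proof (cases "z = x")
  case False
  have in_S: "x + t * (z - x) \<in> S" if "0 < t" "t < 1" for t
    using convexD[OF assms(1,2,3), of "1 - t" t] that by (simp add: algebra_simps)
  have lim: "filterlim (\<lambda>t. x + t * (z - x)) (at x within S) (at_right 0)"
    unfolding filterlim_at
  proof
    show "\<forall>\<^sub>F t in at_right 0. x + t * (z - x) \<in> S \<and> x + t * (z - x) \<noteq> x"
      using eventually_at_right_real[of 0 1] False in_S by (auto elim!: eventually_mono)
    have "((\<lambda>t. x + t * (z - x)) \<longlongrightarrow> x + 0 * (z - x)) (at_right 0)"
      by (intro tendsto_intros)
    then show "((\<lambda>t. x + t * (z - x)) \<longlongrightarrow> x) (at_right 0)" by simp
  qed
  have "((\<lambda>y. (f y - f x) / (y - x)) \<longlongrightarrow> D) (at x within S)"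
    using f by (simp add: has_field_derivative_iff)
  from tendsto_mult[OF filterlim_compose[OF this lim] tendsto_const]
  have "((\<lambda>t. (f (x + t * (z - x)) - f x) / (x + t * (z - x) - x) * (z - x)) \<longlongrightarrow> D * (z - x)) (at_right 0)" .
  moreover have "\<forall>\<^sub>F t in at_right 0. 0 \<le> (f (x + t * (z - x)) - f x) / (x + t * (z - x) - x) * (z - x)"
    using eventually_at_right_real[of 0 1]
  proof (rule eventually_mono)
    fix t :: real assume "t \<in> {0<..<1}"
    then show "0 \<le> (f (x + t * (z - x)) - f x) / (x + t * (z - x) - x) * (z - x)"
      using min[OF in_S, of t] False by simp
  qed simp
  ultimately show ?thesis
    by (rule tendsto_lowerbound) simp
qed simp

lemma finite_uniform_bound:
  fixes f :: "'a \<Rightarrow> 'b \<Rightarrow> real"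
  assumes "finite A" "\<And>i. i \<in> A \<Longrightarrow> \<exists>B. \<forall>t\<in>T i. f i t \<le> B"
  shows "\<exists>B\<ge>0. \<forall>i\<in>A. \<forall>t\<in>T i. f i t \<le> B"
proof -
  obtain b where b: "\<And>i t. i \<in> A \<Longrightarrow> t \<in> T i \<Longrightarrow> f i t \<le> b i"
    using assms(2) by metis
  have "b i \<le> (\<Sum>i\<in>A. \<bar>b i\<bar>)" if "i \<in> A" for i
    using member_le_sum[OF that, of "\<lambda>i. \<bar>b i\<bar>"] assms(1) by simp
  then show ?thesis
    using b by (intro exI[of _ "\<Sum>i\<in>A. \<bar>b i\<bar>"]) (auto intro: sum_nonneg order_trans)
qed

text \<open>Inside this locale the costs appear only through their partial derivatives
  \<open>dJ\<close>, and the equilibrium only through its first-order condition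
  \<open>variational\<close>.\<close>

locale gossip_game =
  fixes N :: nat and EI Em EC :: "(nat \<times> nat) set" and \<Omega> :: "nat \<Rightarrow> real set"
    and dJ :: "nat \<Rightarrow> real \<Rightarrow> (nat \<Rightarrow> real) \<Rightarrow> real" and \<sigma> L :: "nat \<Rightarrow> real" and xs :: "nat \<Rightarrow> real"
  assumes N2: "N \<ge> 2"
    and GI: "simple_graph {1..N} EI" "graph_connected {1..N} EI"
    and Gm: "max_triangle_free_spanning_subgraph {1..N} EI Em"
    and GC: "Em \<subseteq> EC" "EC \<subseteq> EI"
    and Omega: "\<And>i. i \<in> {1..N} \<Longrightarrow> \<Omega> i \<noteq> {} \<and> compact (\<Omega> i) \<and> convex (\<Omega> i)"
    and strict_mono: "\<And>x y. x \<in> (\<Pi>\<^sub>E i\<in>{1..N}. \<Omega> i) \<Longrightarrow> y \<in> (\<Pi>\<^sub>E i\<in>{1..N}. \<Omega> i) \<Longrightarrow> x \<noteq> y \<Longrightarrow>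
                  (\<Sum>i\<in>{1..N}. (pseudo_grad EI dJ x i - pseudo_grad EI dJ y i) * (x i - y i)) > 0"
    and L_pos: "\<And>i. i \<in> {1..N} \<Longrightarrow> L i > 0"
    and lip_own: "\<And>i u x y. i \<in> {1..N} \<Longrightarrow> u \<in> (\<Pi>\<^sub>E j\<in>nbrs EI i. \<Omega> j) \<Longrightarrow> x \<in> \<Omega> i \<Longrightarrow> y \<in> \<Omega> i \<Longrightarrow>
                  \<bar>dJ i x u - dJ i y u\<bar> \<le> \<sigma> i * \<bar>x - y\<bar>"
    and lip_others: "\<And>i x u v. i \<in> {1..N} \<Longrightarrow> x \<in> \<Omega> i \<Longrightarrow>
                  u \<in> (\<Pi>\<^sub>E j\<in>nbrs EI i. \<Omega> j) \<Longrightarrow> v \<in> (\<Pi>\<^sub>E j\<in>nbrs EI i. \<Omega> j) \<Longrightarrow>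
                  \<bar>dJ i x u - dJ i x v\<bar> \<le> L i * sqrt (\<Sum>j\<in>nbrs EI i. (u j - v j)\<^sup>2)"
    and xs: "xs \<in> (\<Pi>\<^sub>E i\<in>{1..N}. \<Omega> i)"
    and variational: "\<And>i z. i \<in> {1..N} \<Longrightarrow> z \<in> \<Omega> i \<Longrightarrow> 0 \<le> pseudo_grad EI dJ xs i * (z - xs i)"
begin

lemma nbrs_in: "j \<in> nbrs EI i \<Longrightarrow> j \<in> {1..N}"
  using nbrs_subset[OF GI(1), of i] by auto

lemma nbrs_nonempty:
  assumes j: "j \<in> {1..N}"
  shows "nbrs EI j \<noteq> {}"
proof -
  obtain v where v: "v \<in> {1..N}" "v \<noteq> j"
  proof (cases "j = 1")
    case True
    then show thesis using N2 that[of 2] by auto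
  next
    case False
    then show thesis using N2 that[of 1] by auto
  qed
  then have "(j, v) \<in> EI\<^sup>*" using GI(2) j by (auto simp: graph_connected_def)
  then show ?thesis using v(2) by (auto simp: nbrs_def elim: converse_rtranclE)
qed

lemma restrict_profile: "x \<in> (\<Pi>\<^sub>E i\<in>{1..N}. \<Omega> i) \<Longrightarrow> restrict x (nbrs EI i) \<in> (\<Pi>\<^sub>E j\<in>nbrs EI i. \<Omega> j)"
  by (rule restrict_PiE_iff[THEN iffD2]) (blast intro: PiE_mem nbrs_in)

lemma abs_diff_bound:
  obtains D where "0 \<le> D" "\<And>i x y. i \<in> {1..N} \<Longrightarrow> x \<in> \<Omega> i \<Longrightarrow> y \<in> \<Omega> i \<Longrightarrow> \<bar>x - y\<bar> \<le> D"
proof -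
  have "\<exists>B. \<forall>t\<in>\<Omega> i. \<bar>t\<bar> \<le> B" if "i \<in> {1..N}" for i
    using Omega[OF that] compact_imp_bounded[of "\<Omega> i"] by (auto simp: bounded_real)
  then obtain B where B: "0 \<le> B" "\<And>i t. i \<in> {1..N} \<Longrightarrow> t \<in> \<Omega> i \<Longrightarrow> \<bar>t\<bar> \<le> B"
    using finite_uniform_bound[of "{1..N}" \<Omega> "\<lambda>_ t. \<bar>t\<bar>"] by blast
  have "\<bar>x - y\<bar> \<le> 2 * B" if "i \<in> {1..N}" "x \<in> \<Omega> i" "y \<in> \<Omega> i" for i x y
    using B(2)[OF that(1,2)] B(2)[OF that(1,3)] by linarith
  then show thesis using B(1) by (intro that[of "2 * B"]) auto
qed

lemma lip_joint:
  assumes i: "i \<in> {1..N}" and "x \<in> \<Omega> i" "y \<in> \<Omega> i"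
    and "u \<in> (\<Pi>\<^sub>E j\<in>nbrs EI i. \<Omega> j)" "v \<in> (\<Pi>\<^sub>E j\<in>nbrs EI i. \<Omega> j)"
  shows "\<bar>dJ i x u - dJ i y v\<bar> \<le> \<bar>\<sigma> i\<bar> * \<bar>x - y\<bar> + L i * (\<Sum>j\<in>nbrs EI i. \<bar>u j - v j\<bar>)"
proof -
  have "\<bar>dJ i x u - dJ i y u\<bar> \<le> \<sigma> i * \<bar>x - y\<bar>" using assms by (intro lip_own)
  also have "\<dots> \<le> \<bar>\<sigma> i\<bar> * \<bar>x - y\<bar>" by (intro mult_right_mono) auto
  finally have 1: "\<bar>dJ i x u - dJ i y u\<bar> \<le> \<bar>\<sigma> i\<bar> * \<bar>x - y\<bar>" .
  have "\<bar>dJ i y u - dJ i y v\<bar> \<le> L i * L2_set (\<lambda>j. u j - v j) (nbrs EI i)"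
    unfolding L2_set_def using assms by (intro lip_others)
  also have "\<dots> \<le> L i * (\<Sum>j\<in>nbrs EI i. \<bar>u j - v j\<bar>)"
    using L_pos[OF i] by (intro mult_left_mono L2_set_le_sum_abs) auto
  finally show ?thesis using 1 by linarith
qed

text \<open>Lipschitz continuity on sets of finite diameter reduces the bound to the value at one
  reference profile, here \<open>xs\<close>.\<close>

lemma gradient_bound:
  obtains G where "0 \<le> G" "\<And>i x u. i \<in> {1..N} \<Longrightarrow> x \<in> \<Omega> i \<Longrightarrow> u \<in> (\<Pi>\<^sub>E j\<in>nbrs EI i. \<Omega> j) \<Longrightarrow> \<bar>dJ i x u\<bar> \<le> G"
proof -
  obtain D where D: "0 \<le> D" "\<And>i x y. i \<in> {1..N} \<Longrightarrow> x \<in> \<Omega> i \<Longrightarrow> y \<in> \<Omega> i \<Longrightarrow> \<bar>x - y\<bar> \<le> D"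
    using abs_diff_bound by blast
  define T where "T i = \<Omega> i \<times> (\<Pi>\<^sub>E j\<in>nbrs EI i. \<Omega> j)" for i
  have "\<exists>B. \<forall>t\<in>T i. (\<lambda>i t. \<bar>dJ i (fst t) (snd t)\<bar>) i t \<le> B" if i: "i \<in> {1..N}" for i
  proof (intro exI ballI)
    let ?v = "restrict xs (nbrs EI i)"
    fix t assume t: "t \<in> T i"
    have xsi: "xs i \<in> \<Omega> i" using xs i by (rule PiE_mem)
    have v: "?v \<in> (\<Pi>\<^sub>E j\<in>nbrs EI i. \<Omega> j)" using xs by (rule restrict_profile)
    have t: "fst t \<in> \<Omega> i" "snd t \<in> (\<Pi>\<^sub>E j\<in>nbrs EI i. \<Omega> j)"
      using t by (simp_all add: T_def mem_Times_iff)
    have "\<bar>dJ i (fst t) (snd t) - dJ i (xs i) ?v\<bar>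
        \<le> \<bar>\<sigma> i\<bar> * \<bar>fst t - xs i\<bar> + L i * (\<Sum>j\<in>nbrs EI i. \<bar>snd t j - ?v j\<bar>)"
      by (intro lip_joint i t xsi v)
    also have "\<dots> \<le> \<bar>\<sigma> i\<bar> * D + L i * (\<Sum>j\<in>nbrs EI i. D)"
    proof (intro add_mono mult_left_mono sum_mono)
      show "\<bar>fst t - xs i\<bar> \<le> D" by (rule D(2)[OF i t(1) xsi])
      fix j assume j: "j \<in> nbrs EI i"
      show "\<bar>snd t j - ?v j\<bar> \<le> D"
        by (rule D(2)[OF nbrs_in[OF j] PiE_mem[OF t(2) j] PiE_mem[OF v j]])
    qed (use L_pos[OF i] in auto)
    finally show "(\<lambda>i t. \<bar>dJ i (fst t) (snd t)\<bar>) i t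
        \<le> \<bar>dJ i (xs i) ?v\<bar> + (\<bar>\<sigma> i\<bar> * D + L i * (\<Sum>j\<in>nbrs EI i. D))"
      by simp
  qed
  from finite_uniform_bound[of "{1..N}" T "\<lambda>i t. \<bar>dJ i (fst t) (snd t)\<bar>", OF finite_atLeastAtMost this]
  obtain B where B: "0 \<le> B" "\<forall>i\<in>{1..N}. \<forall>t\<in>T i. \<bar>dJ i (fst t) (snd t)\<bar> \<le> B"
    by blast
  have "\<bar>dJ i x u\<bar> \<le> B" if "i \<in> {1..N}" "x \<in> \<Omega> i" "u \<in> (\<Pi>\<^sub>E j\<in>nbrs EI i. \<Omega> j)" for i x u
  proof -
    have "(x, u) \<in> T i" unfolding T_def using that(2,3) by (rule SigmaI)
    then show ?thesis using bspec[OF bspec[OF B(2) that(1)], of "(x, u)"] by simp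
  qed
  with B(1) show thesis by (rule that)
qed

text \<open>Half of the first-order decrease, per unit of step, of the squared distance of player
  \<open>i\<close> to the equilibrium. It is kept per player because the players' steps
  differ.\<close>

definition gap :: "(nat \<Rightarrow> real) \<Rightarrow> nat \<Rightarrow> real" where
  "gap x i = pseudo_grad EI dJ x i * (x i - xs i)"

lemma gap_sum_pos:
  assumes "x \<in> (\<Pi>\<^sub>E i\<in>{1..N}. \<Omega> i)" "x \<noteq> xs"
  shows "0 < (\<Sum>i\<in>{1..N}. gap x i)"
proof -
  have "0 < (\<Sum>i\<in>{1..N}. (pseudo_grad EI dJ x i - pseudo_grad EI dJ xs i) * (x i - xs i))"
    using strict_mono[OF assms(1) xs assms(2)] .
  also have "\<dots> \<le> (\<Sum>i\<in>{1..N}. gap x i)"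
  proof (rule sum_mono)
    fix i assume i: "i \<in> {1..N}"
    have "0 \<le> pseudo_grad EI dJ xs i * (x i - xs i)" by (rule variational[OF i PiE_mem[OF assms(1) i]])
    then show "(pseudo_grad EI dJ x i - pseudo_grad EI dJ xs i) * (x i - xs i) \<le> gap x i"
      by (simp add: gap_def algebra_simps)
  qed
  finally show ?thesis .
qed

lemma gap_sum_nonneg: "x \<in> (\<Pi>\<^sub>E i\<in>{1..N}. \<Omega> i) \<Longrightarrow> 0 \<le> (\<Sum>i\<in>{1..N}. gap x i)"
proof (cases "x = xs")
  case True
  then show ?thesis by (simp add: gap_def)
next
  case False
  assume "x \<in> (\<Pi>\<^sub>E i\<in>{1..N}. \<Omega> i)"
  then show ?thesis using False by (intro less_imp_le gap_sum_pos)
qed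

lemma pseudo_grad_lipschitz:
  assumes "i \<in> {1..N}" "x \<in> (\<Pi>\<^sub>E i\<in>{1..N}. \<Omega> i)" "y \<in> (\<Pi>\<^sub>E i\<in>{1..N}. \<Omega> i)"
  shows "\<bar>pseudo_grad EI dJ x i - pseudo_grad EI dJ y i\<bar>
    \<le> \<bar>\<sigma> i\<bar> * \<bar>x i - y i\<bar> + L i * (\<Sum>j\<in>nbrs EI i. \<bar>x j - y j\<bar>)"
proof -
  have "\<bar>pseudo_grad EI dJ x i - pseudo_grad EI dJ y i\<bar> \<le> \<bar>\<sigma> i\<bar> * \<bar>x i - y i\<bar>
      + L i * (\<Sum>j\<in>nbrs EI i. \<bar>restrict x (nbrs EI i) j - restrict y (nbrs EI i) j\<bar>)"
    unfolding pseudo_grad_def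
    by (rule lip_joint[OF assms(1) PiE_mem[OF assms(2,1)] PiE_mem[OF assms(3,1)]
          restrict_profile[OF assms(2)] restrict_profile[OF assms(3)]])
  also have "(\<Sum>j\<in>nbrs EI i. \<bar>restrict x (nbrs EI i) j - restrict y (nbrs EI i) j\<bar>)
      = (\<Sum>j\<in>nbrs EI i. \<bar>x j - y j\<bar>)"
    by (intro sum.cong refl) simp
  finally show ?thesis .
qed

text \<open>Compactness supplies the modulus that strict monotonicity lacks: the Lipschitz bounds
  make the sum continuous, so it attains its minimum over the profiles at squared distance at least
  \<delta>, if there are any.\<close>

lemma gap_sum_uniform_pos:
  assumes "\<delta> > 0"
  shows "\<exists>\<eta>>0. \<forall>x\<in>(\<Pi>\<^sub>E i\<in>{1..N}. \<Omega> i). \<delta> \<le> (\<Sum>i\<in>{1..N}. (x i - xs i)\<^sup>2) \<longrightarrow> \<eta> \<le> (\<Sum>i\<in>{1..N}. gap x i)"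
proof -
  let ?X = "\<Pi>\<^sub>E i\<in>{1..N}. \<Omega> i"
  have coord: "continuous_on A (\<lambda>x :: nat \<Rightarrow> real. x i)" for A i
    by (rule continuous_on_subset[OF continuous_on_product_coordinates]) simp
  \<comment> \<open>A profile is \<open>undefined\<close> outside the players. In a product over all
    naturals those coordinates range over a singleton, so Tychonoff's theorem applies in the full
    function space.\<close>
  have "?X = (\<Pi>\<^sub>E i\<in>UNIV. if i \<in> {1..N} then \<Omega> i else {undefined})"
    by (auto simp: PiE_def extensional_def Pi_def split: if_splits)
  moreover have "compactin (product_topology (\<lambda>i. euclidean) UNIV)
      (\<Pi>\<^sub>E i\<in>UNIV. if i \<in> {1..N} then \<Omega> i else {undefined})"
    using Omega by (auto simp: compactin_PiE)
  ultimately have "compact ?X"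
    by (simp add: euclidean_product_topology)
  have grad: "continuous_on ?X (\<lambda>x. pseudo_grad EI dJ x i)" if i: "i \<in> {1..N}" for i
    unfolding continuous_on_def
  proof
    fix y assume y: "y \<in> ?X"
    have tend: "((\<lambda>x. x j) \<longlongrightarrow> y j) (at y within ?X)" for j
      using coord[of ?X j] y by (auto simp: continuous_on_def)
    have "((\<lambda>x. \<bar>\<sigma> i\<bar> * \<bar>x i - y i\<bar> + L i * (\<Sum>j\<in>nbrs EI i. \<bar>x j - y j\<bar>)) \<longlongrightarrow>
        \<bar>\<sigma> i\<bar> * \<bar>y i - y i\<bar> + L i * (\<Sum>j\<in>nbrs EI i. \<bar>y j - y j\<bar>)) (at y within ?X)"
      by (intro tendsto_intros tend)
    then have "((\<lambda>x. \<bar>\<sigma> i\<bar> * \<bar>x i - y i\<bar> + L i * (\<Sum>j\<in>nbrs EI i. \<bar>x j - y j\<bar>)) \<longlongrightarrow> 0) (at y within ?X)"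
      by simp
    moreover have "\<forall>\<^sub>F x in at y within ?X. norm (pseudo_grad EI dJ x i - pseudo_grad EI dJ y i)
        \<le> \<bar>\<sigma> i\<bar> * \<bar>x i - y i\<bar> + L i * (\<Sum>j\<in>nbrs EI i. \<bar>x j - y j\<bar>)"
      unfolding eventually_at_filter using pseudo_grad_lipschitz[OF i _ y] by (auto intro: always_eventually)
    ultimately have "((\<lambda>x. pseudo_grad EI dJ x i - pseudo_grad EI dJ y i) \<longlongrightarrow> 0) (at y within ?X)"
      by (rule Lim_null_comparison[rotated])
    then show "((\<lambda>x. pseudo_grad EI dJ x i) \<longlongrightarrow> pseudo_grad EI dJ y i) (at y within ?X)"
      by (simp add: LIM_zero_iff)
  qed
  have cont: "continuous_on ?X (\<lambda>x. \<Sum>i\<in>{1..N}. gap x i)"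
    unfolding gap_def by (intro continuous_intros grad coord) auto
  define K where "K = ?X \<inter> {x. \<delta> \<le> (\<Sum>i\<in>{1..N}. (x i - xs i)\<^sup>2)}"
  have "closed {x :: nat \<Rightarrow> real. \<delta> \<le> (\<Sum>i\<in>{1..N}. (x i - xs i)\<^sup>2)}"
    by (intro closed_Collect_le continuous_intros coord)
  then have "compact K"
    unfolding K_def using \<open>compact ?X\<close> by (rule compact_Int_closed[rotated])
  show ?thesis
  proof (cases "K = {}")
    case True
    then show ?thesis by (intro exI[of _ 1]) (auto simp: K_def)
  next
    case False
    obtain z where z: "z \<in> K" "\<And>x. x \<in> K \<Longrightarrow> (\<Sum>i\<in>{1..N}. gap z i) \<le> (\<Sum>i\<in>{1..N}. gap x i)"
      using continuous_attains_inf[OF \<open>compact K\<close> False continuous_on_subset[OF cont]]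
      by (auto simp: K_def)
    have "z \<noteq> xs" using z(1) assms by (auto simp: K_def)
    then have "0 < (\<Sum>i\<in>{1..N}. gap z i)" using z(1) by (intro gap_sum_pos) (auto simp: K_def)
    then show ?thesis using z(2) by (intro exI[of _ "\<Sum>i\<in>{1..N}. gap z i"]) (auto simp: K_def)
  qed
qed

text \<open>Controls how much a single player's \<open>gap\<close> changes in one iteration, which
  is the price of the summation by parts in \<open>x_tendsto\<close>.\<close>

lemma gap_lipschitz:
  obtains H where "0 \<le> H"
    "\<And>i x y. i \<in> {1..N} \<Longrightarrow> x \<in> (\<Pi>\<^sub>E i\<in>{1..N}. \<Omega> i) \<Longrightarrow> y \<in> (\<Pi>\<^sub>E i\<in>{1..N}. \<Omega> i) \<Longrightarrow>
       \<bar>gap x i - gap y i\<bar> \<le> H * (\<Sum>j\<in>{1..N}. \<bar>x j - y j\<bar>)"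
proof -
  obtain D where D: "0 \<le> D" "\<And>i x y. i \<in> {1..N} \<Longrightarrow> x \<in> \<Omega> i \<Longrightarrow> y \<in> \<Omega> i \<Longrightarrow> \<bar>x - y\<bar> \<le> D"
    using abs_diff_bound by blast
  obtain G where G: "0 \<le> G"
    "\<And>i x u. i \<in> {1..N} \<Longrightarrow> x \<in> \<Omega> i \<Longrightarrow> u \<in> (\<Pi>\<^sub>E j\<in>nbrs EI i. \<Omega> j) \<Longrightarrow> \<bar>dJ i x u\<bar> \<le> G"
    using gradient_bound by blast
  obtain B where B: "0 \<le> B" "\<And>i. i \<in> {1..N} \<Longrightarrow> (\<bar>\<sigma> i\<bar> + L i) * D + G \<le> B"
    using finite_uniform_bound[of "{1..N}" "\<lambda>_. {()}" "\<lambda>i _. (\<bar>\<sigma> i\<bar> + L i) * D + G"] by blast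
  show thesis
  proof (rule that[OF B(1)])
    fix i x y assume i: "i \<in> {1..N}"
      and x: "x \<in> (\<Pi>\<^sub>E i\<in>{1..N}. \<Omega> i)" and y: "y \<in> (\<Pi>\<^sub>E i\<in>{1..N}. \<Omega> i)"
    define s where "s = (\<Sum>j\<in>{1..N}. \<bar>x j - y j\<bar>)"
    have s: "0 \<le> s" unfolding s_def by (intro sum_nonneg) auto
    have 1: "\<bar>x i - y i\<bar> \<le> s" unfolding s_def using i by (intro member_le_sum) auto
    have 2: "(\<Sum>j\<in>nbrs EI i. \<bar>x j - y j\<bar>) \<le> s"
      unfolding s_def using nbrs_in by (intro sum_mono2) auto
    have "\<bar>pseudo_grad EI dJ x i - pseudo_grad EI dJ y i\<bar> \<le> \<bar>\<sigma> i\<bar> * s + L i * s"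
      using pseudo_grad_lipschitz[OF i x y] mult_left_mono[OF 1, of "\<bar>\<sigma> i\<bar>"]
        mult_left_mono[OF 2 less_imp_le[OF L_pos[OF i]]] by simp
    then have 3: "\<bar>pseudo_grad EI dJ x i - pseudo_grad EI dJ y i\<bar> * \<bar>x i - xs i\<bar> \<le> ((\<bar>\<sigma> i\<bar> + L i) * s) * D"
      using i s L_pos[OF i] by (intro mult_mono D(2)[OF i PiE_mem[OF x i] PiE_mem[OF xs i]]) (auto simp: distrib_right)
    have "\<bar>pseudo_grad EI dJ y i\<bar> \<le> G"
      unfolding pseudo_grad_def by (rule G(2)[OF i PiE_mem[OF y i] restrict_profile[OF y]])
    then have 4: "\<bar>pseudo_grad EI dJ y i\<bar> * \<bar>x i - y i\<bar> \<le> G * s"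
      using 1 G(1) by (intro mult_mono) auto
    have "gap x i - gap y i = (pseudo_grad EI dJ x i - pseudo_grad EI dJ y i) * (x i - xs i)
        + pseudo_grad EI dJ y i * (x i - y i)"
      by (simp add: gap_def algebra_simps)
    then have "\<bar>gap x i - gap y i\<bar> \<le> \<bar>pseudo_grad EI dJ x i - pseudo_grad EI dJ y i\<bar> * \<bar>x i - xs i\<bar>
        + \<bar>pseudo_grad EI dJ y i\<bar> * \<bar>x i - y i\<bar>"
      by (metis abs_mult abs_triangle_ineq)
    also have "\<dots> \<le> ((\<bar>\<sigma> i\<bar> + L i) * D + G) * s"
      using 3 4 by (simp add: algebra_simps)
    also have "\<dots> \<le> B * s" using B(2)[OF i] s by (intro mult_right_mono) auto
    finally show "\<bar>gap x i - gap y i\<bar> \<le> B * (\<Sum>j\<in>{1..N}. \<bar>x j - y j\<bar>)" by (simp add: s_def)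
  qed
qed

end

section \<open>Convergence along a typical path\<close>

lemma LIMSEQ_null_le:
  fixes h :: "nat \<Rightarrow> 'a::real_normed_vector"
  shows "f \<longlonglongrightarrow> 0 \<Longrightarrow> (\<And>k. norm (h k) \<le> f k) \<Longrightarrow> h \<longlonglongrightarrow> 0"
  by (rule Lim_null_comparison[OF always_eventually]) auto

locale gossip_path = gossip_game +
  fixes x0 :: "nat \<Rightarrow> real" and \<omega> :: "(nat \<times> nat) stream"
  assumes init: "\<And>i j. i \<in> {1..N} \<Longrightarrow> j \<in> cnbrs EI i \<Longrightarrow> x0 (sidx EI i j) \<in> \<Omega> j"
    and letters: "\<And>t. \<omega> !! t \<in> EC"
    and update_freq: "\<And>i. i \<in> {1..N} \<Longrightarrow> \<exists>p>0.
      (\<lambda>n. real (card {t. t < n \<and> (fst (\<omega> !! t) = i \<or> snd (\<omega> !! t) = i)}) / real n) \<longlonglongrightarrow> p"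
    and word_freq: "\<And>w. w \<noteq> [] \<Longrightarrow> set w \<subseteq> EC \<Longrightarrow> \<exists>q>0.
      (\<lambda>n. real (card {t. t < n \<and> stake (length w) (sdrop (t * length w) \<omega>) = w}) / real n) \<longlonglongrightarrow> q"
begin

text \<open>
  Along the path, \<open>y k i j\<close> is the estimate of the action of \<open>j\<close> held by \<open>i\<close> at time \<open>k\<close>
  (\<open>y k i i\<close> being the action of \<open>i\<close> itself), \<open>z\<close> collects the averaged estimates, \<open>g\<close> the
  gradients evaluated at them, and \<open>a k i\<close> is the step size, set to 0 when \<open>i\<close> is idle.
\<close>
definition y :: "nat \<Rightarrow> nat \<Rightarrow> nat \<Rightarrow> real" where
  "y k i j = gossip_traj N EI \<Omega> dJ x0 \<omega> k (sidx EI i j)"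

definition x :: "nat \<Rightarrow> nat \<Rightarrow> real" where
  "x k = restrict (\<lambda>i. y k i i) {1..N}"

definition z :: "nat \<Rightarrow> nat \<Rightarrow> nat \<Rightarrow> real" where
  "z k = gossip_avg EI (fst (\<omega> !! k)) (snd (\<omega> !! k)) (y k)"

definition g :: "nat \<Rightarrow> nat \<Rightarrow> real" where
  "g k i = dJ i (x k i) (restrict (z k i) (nbrs EI i))"

definition a :: "nat \<Rightarrow> nat \<Rightarrow> real" where
  "a k i = (if fst (\<omega> !! k) = i \<or> snd (\<omega> !! k) = i then 1 / real (num_updates \<omega> k i) else 0)"

section \<open>Feasibility of the trajectory and the projected step\<close>

lemma letter: "(fst (\<omega> !! k), snd (\<omega> !! k)) \<in> EI"
  using letters[of k] GC by auto

lemma x_eq: "i \<in> {1..N} \<Longrightarrow> x k i = y k i i"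
  by (simp add: x_def)

lemma y_Suc_nbr:
  assumes "i \<in> {1..N}" "j \<in> nbrs EI i"
  shows "y (Suc k) i j = z k i j"
  unfolding y_def z_def gossip_traj.simps
  by (subst prod.collapse[symmetric, of "\<omega> !! k"]) (rule gossip_step_neighbour[OF GI(1) letter assms])

lemma y_Suc_own:
  assumes "i \<in> {1..N}"
  shows "y (Suc k) i i = (if fst (\<omega> !! k) = i \<or> snd (\<omega> !! k) = i
    then closest_point (\<Omega> i) (y k i i - a k i * g k i) else y k i i)"
  unfolding y_def gossip_traj.simps
  by (subst prod.collapse[symmetric, of "\<omega> !! k"], subst gossip_step_own[OF GI(1) letter assms])
    (auto simp: a_def g_def z_def x_eq[OF assms] y_def[abs_def])

lemma z_cases:
  assumes "i \<in> {1..N}" "j \<in> cnbrs EI i"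
  obtains "z k i j = y k i j"
  | i' where "i' \<in> cnbrs EI j" "z k i j = (y k i j + y k i' j) / 2"
  using that assms cnbrs_sym[OF GI(1)] unfolding z_def gossip_avg_def
  by (metis add.commute)

text \<open>Means stay feasible by convexity, own actions by projection. The two claims alternate in
  time, so the one about \<open>z\<close> is first proved relative to the feasibility of
  \<open>y\<close> at the same time and then used inside the induction.\<close>

lemma y_in: "i \<in> {1..N} \<Longrightarrow> j \<in> cnbrs EI i \<Longrightarrow> y k i j \<in> \<Omega> j"
  and z_in: "i \<in> {1..N} \<Longrightarrow> j \<in> cnbrs EI i \<Longrightarrow> z k i j \<in> \<Omega> j"
proof -
  have z_in: "z k i j \<in> \<Omega> j"
    if IH: "\<And>i j. i \<in> {1..N} \<Longrightarrow> j \<in> cnbrs EI i \<Longrightarrow> y k i j \<in> \<Omega> j" and ij: "i \<in> {1..N}" "j \<in> cnbrs EI i"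
    for k i j
  proof -
    have j: "j \<in> {1..N}" using cnbrs_subset[OF GI(1) ij(1)] ij(2) by blast
    show ?thesis
    proof (rule z_cases[OF ij, of k])
      fix i' assume i': "i' \<in> cnbrs EI j" and z: "z k i j = (y k i j + y k i' j) / 2"
      have "i' \<in> {1..N}" "j \<in> cnbrs EI i'"
        using i' cnbrs_subset[OF GI(1) j] cnbrs_sym[OF GI(1)] by blast+
      then have "(1/2) *\<^sub>R y k i j + (1/2) *\<^sub>R y k i' j \<in> \<Omega> j"
        using Omega[OF j] IH ij by (intro convexD) auto
      then show ?thesis by (simp add: z add_divide_distrib)
    qed (use IH ij in simp)
  qed
  have y_in: "y k i j \<in> \<Omega> j" if "i \<in> {1..N}" "j \<in> cnbrs EI i" for k i j
    using that
  proof (induction k arbitrary: i j)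
    case 0
    then show ?case using init by (simp add: y_def)
  next
    case (Suc k)
    show ?case
    proof (cases "j = i")
      case True
      have "closest_point (\<Omega> i) c \<in> \<Omega> i" for c
        using Omega[OF Suc.prems(1)] by (intro closest_point_in_set compact_imp_closed) auto
      then show ?thesis
        using True Suc y_Suc_own[OF Suc.prems(1)] by simp
    next
      case False
      then have "j \<in> nbrs EI i" using Suc.prems by (simp add: cnbrs_def)
      then show ?thesis using y_Suc_nbr[OF Suc.prems(1)] z_in[OF Suc.IH Suc.prems] by simp
    qed
  qed
  show "i \<in> {1..N} \<Longrightarrow> j \<in> cnbrs EI i \<Longrightarrow> y k i j \<in> \<Omega> j" by (rule y_in)
  show "i \<in> {1..N} \<Longrightarrow> j \<in> cnbrs EI i \<Longrightarrow> z k i j \<in> \<Omega> j" by (rule z_in[OF y_in])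
qed

lemma x_in: "x k \<in> (\<Pi>\<^sub>E i\<in>{1..N}. \<Omega> i)"
  unfolding x_def by (rule restrict_PiE_iff[THEN iffD2]) (blast intro: y_in[unfolded cnbrs_def])

lemma x_in': "i \<in> {1..N} \<Longrightarrow> x k i \<in> \<Omega> i"
  using x_in by (rule PiE_mem)

lemma z_profile: "i \<in> {1..N} \<Longrightarrow> restrict (z k i) (nbrs EI i) \<in> (\<Pi>\<^sub>E j\<in>nbrs EI i. \<Omega> j)"
  by (rule restrict_PiE_iff[THEN iffD2]) (simp add: z_in cnbrs_def)

text \<open>One formula for active and idle players: an idle one has step 0, and projecting a
  feasible point does nothing.\<close>

lemma x_Suc:
  assumes i: "i \<in> {1..N}"
  shows "x (Suc k) i = closest_point (\<Omega> i) (x k i - a k i * g k i)"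
  using y_Suc_own[OF i, of k] closest_point_self[OF x_in'[OF i, of k]] x_eq[OF i]
  by (auto simp: a_def)

lemma x_Suc_dist:
  assumes i: "i \<in> {1..N}" and c: "c \<in> \<Omega> i"
  shows "\<bar>x (Suc k) i - c\<bar> \<le> \<bar>x k i - a k i * g k i - c\<bar>"
  using closest_point_lipschitz[of "\<Omega> i" "x k i - a k i * g k i" c] closest_point_self[OF c] Omega[OF i]
  by (simp add: x_Suc[OF i] dist_real_def compact_imp_closed)

section \<open>Step sizes and movements of order 1/k\<close>

lemma a_nonneg: "0 \<le> a k i"
  by (simp add: a_def)

text \<open>The current iteration is included in the count, hence the shift to \<open>Suc k\<close>;
  it also keeps the step of an active player away from a division by 0.\<close>

lemma num_updates_eq:
  "num_updates \<omega> k i = card {t. t < Suc k \<and> (fst (\<omega> !! t) = i \<or> snd (\<omega> !! t) = i)}"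
  by (simp add: num_updates_def less_Suc_eq_le)

text \<open>The quotient of \<open>Suc k\<close> by the number of updates converges to
  \<open>inverse p\<close> and is therefore bounded at all indices; before the first update it is 0
  by convention.\<close>

lemma a_bound:
  obtains C where "0 \<le> C" "\<And>i k. i \<in> {1..N} \<Longrightarrow> a k i \<le> C / real (Suc k)"
proof -
  have "\<exists>B. \<forall>k\<in>UNIV. a k i * real (Suc k) \<le> B" if i: "i \<in> {1..N}" for i
  proof -
    obtain p where p: "p > 0"
      "(\<lambda>n. real (card {t. t < n \<and> (fst (\<omega> !! t) = i \<or> snd (\<omega> !! t) = i)}) / real n) \<longlonglongrightarrow> p"
      using update_freq[OF i] by blast
    have "(\<lambda>k. real (num_updates \<omega> k i) / real (Suc k)) \<longlonglongrightarrow> p"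
      using LIMSEQ_Suc[OF p(2)] by (simp only: num_updates_eq)
    then have "(\<lambda>k. inverse (real (num_updates \<omega> k i) / real (Suc k))) \<longlonglongrightarrow> inverse p"
      using p(1) by (intro tendsto_inverse) auto
    then have "Bseq (\<lambda>k. real (Suc k) / real (num_updates \<omega> k i))"
      by (intro convergent_imp_Bseq convergentI) simp
    then obtain B where B: "\<And>k. norm (real (Suc k) / real (num_updates \<omega> k i)) \<le> B"
      by (auto simp: Bseq_def)
    have "a k i * real (Suc k) \<le> B" for k
      using B[of k] by (auto simp: a_def intro: order_trans[OF _ B[of k]])
    then show ?thesis by blast
  qed
  then have "\<exists>B\<ge>0. \<forall>i\<in>{1..N}. \<forall>k\<in>UNIV. a k i * real (Suc k) \<le> B"
    by (intro finite_uniform_bound) auto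
  then obtain B where "0 \<le> B" "\<And>i k. i \<in> {1..N} \<Longrightarrow> a k i * real (Suc k) \<le> B" by blast
  then show thesis by (intro that[of B]) (auto simp: field_simps)
qed

lemma step_noise_convergent:
  assumes i: "i \<in> {1..N}"
  shows "convergent (\<lambda>k. \<Sum>s<k. a s i - 1 / real (Suc s))"
proof -
  obtain p where p: "p > 0"
    "(\<lambda>n. real (card {t. t < n \<and> (fst (\<omega> !! t) = i \<or> snd (\<omega> !! t) = i)}) / real n) \<longlonglongrightarrow> p"
    using update_freq[OF i] by blast
  let ?U = "{t. fst (\<omega> !! t) = i \<or> snd (\<omega> !! t) = i}"
  have "convergent (\<lambda>k. \<Sum>s<k. (if s \<in> ?U then 1 / real (card {t. t < Suc s \<and> t \<in> ?U}) else 0) - 1 / real (Suc s))"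
    using p by (intro convergent_update_noise[of ?U p]) auto
  then show ?thesis by (simp only: a_def num_updates_eq mem_Collect_eq)
qed

lemma x_move:
  assumes i: "i \<in> {1..N}"
  shows "\<bar>x (Suc k) i - x k i\<bar> \<le> a k i * \<bar>g k i\<bar>"
  using x_Suc_dist[OF i x_in'[OF i], of k k] a_nonneg[of k i] by (simp add: abs_mult)

lemma g_bound:
  obtains G where "0 \<le> G" "\<And>i k. i \<in> {1..N} \<Longrightarrow> \<bar>g k i\<bar> \<le> G"
proof -
  obtain G where G: "0 \<le> G"
    "\<And>i x u. i \<in> {1..N} \<Longrightarrow> x \<in> \<Omega> i \<Longrightarrow> u \<in> (\<Pi>\<^sub>E j\<in>nbrs EI i. \<Omega> j) \<Longrightarrow> \<bar>dJ i x u\<bar> \<le> G"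
    using gradient_bound by blast
  have "\<bar>g k i\<bar> \<le> G" if "i \<in> {1..N}" for i k
    unfolding g_def by (rule G(2)[OF that x_in'[OF that] z_profile[OF that]])
  then show thesis using that[OF G(1)] by blast
qed

lemma x_move_bound:
  obtains B where "0 \<le> B" "\<And>i k. i \<in> {1..N} \<Longrightarrow> \<bar>x (Suc k) i - x k i\<bar> \<le> B / real (Suc k)"
proof -
  obtain C where C: "0 \<le> C" "\<And>i k. i \<in> {1..N} \<Longrightarrow> a k i \<le> C / real (Suc k)" using a_bound by blast
  obtain G where G: "0 \<le> G" "\<And>i k. i \<in> {1..N} \<Longrightarrow> \<bar>g k i\<bar> \<le> G" using g_bound by blast
  have "\<bar>x (Suc k) i - x k i\<bar> \<le> C * G / real (Suc k)" if i: "i \<in> {1..N}" for i k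
  proof -
    have "\<bar>x (Suc k) i - x k i\<bar> \<le> a k i * \<bar>g k i\<bar>" by (rule x_move[OF i])
    also have "\<dots> \<le> C / real (Suc k) * G"
      using C G i a_nonneg by (intro mult_mono) auto
    finally show ?thesis by simp
  qed
  then show thesis using that[of "C * G"] C(1) G(1) by simp
qed

text \<open>Measuring the errors against the current action of \<open>j\<close> makes
  \<open>j\<close> a leader without error; its moves reappear as drift of order \<open>1 / k\<close>
  in the errors of all others.\<close>

lemma estimate_tendsto:
  assumes j: "j \<in> {1..N}" and i: "i \<in> cnbrs EI j"
  shows "(\<lambda>k. y k i j - x k j) \<longlonglongrightarrow> 0"
proof -
  let ?C = "cnbrs EI j"
  obtain B where B: "0 \<le> B" "\<And>i k. i \<in> {1..N} \<Longrightarrow> \<bar>x (Suc k) i - x k i\<bar> \<le> B / real (Suc k)"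
    using x_move_bound by blast
  obtain D where D: "0 \<le> D" "\<And>i x y. i \<in> {1..N} \<Longrightarrow> x \<in> \<Omega> i \<Longrightarrow> y \<in> \<Omega> i \<Longrightarrow> \<bar>x - y\<bar> \<le> D"
    using abs_diff_bound by blast
  have C: "i \<in> {1..N}" "j \<in> cnbrs EI i" if "i \<in> ?C" for i
    using that cnbrs_subset[OF GI(1) j] cnbrs_sym[OF GI(1)] by blast+
  obtain w where w: "set w \<subseteq> EC" "spread ?C {j} w = ?C"
    using exists_spreading_word_cnbrs[OF GI(1) Gm GC(1) j] by blast
  \<comment> \<open>This rules out the empty word, for which blocks would have length 0.\<close>
  have "?C \<noteq> {j}"
    using nbrs_nonempty[OF j] not_in_nbrs[OF GI(1), of j] by (auto simp: cnbrs_def)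
  then have "w \<noteq> []" using w(2) by (metis spread.simps(1))
  obtain q where q: "q > 0"
    "(\<lambda>n. real (card {t. t < n \<and> stake (length w) (sdrop (t * length w) \<omega>) = w}) / real n) \<longlonglongrightarrow> q"
    using word_freq[OF \<open>w \<noteq> []\<close> w(1)] by blast
  show ?thesis
  proof (rule leader_consensus[where C = ?C and e = "\<lambda>k i. y k i j - x k j" and j = j and w = w and \<omega> = \<omega>
        and d = "\<lambda>k. B / real (Suc k)" and B = B and K = D])
    fix k i assume i: "i \<in> ?C"
    note i' = C[OF i]
    show "\<bar>y (Suc k) i j - x (Suc k) j\<bar> \<le> \<bar>pair_avg ?C (\<omega> !! k) (\<lambda>i. y k i j - x k j) i\<bar> + B / real (Suc k)"
    proof (cases "i = j")
      case True
      then show ?thesis using B(1) x_eq[OF j] by simp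
    next
      case False
      then have "y (Suc k) i j = z k i j"
        using i'(2) by (intro y_Suc_nbr i'(1)) (simp add: cnbrs_def)
      moreover have "z k i j - x k j = pair_avg ?C (\<omega> !! k) (\<lambda>i. y k i j - x k j) i"
      proof -
        \<comment> \<open>\<open>gossip_avg\<close> asks whose neighbourhood contains
          \<open>j\<close>, \<open>pair_avg\<close> who lies in the neighbourhood of
          \<open>j\<close>; the relation is symmetric.\<close>
        have "(i = c \<and> j \<in> cnbrs EI d \<or> i = d \<and> j \<in> cnbrs EI c) \<longleftrightarrow> c \<in> ?C \<and> d \<in> ?C \<and> (i = c \<or> i = d)" for c d
          using i cnbrs_sym[OF GI(1)] by blast
        note eq = this
        show ?thesis
          unfolding z_def gossip_avg_def pair_avg_def eq by (auto simp: field_simps)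
      qed
      ultimately show ?thesis using B(2)[OF j, of k] by linarith
    qed
    show "\<bar>y k i j - x k j\<bar> \<le> D" by (rule D(2)[OF j y_in[OF i'] x_in'[OF j]])
  next
    show "finite ?C" by (rule finite_cnbrs[OF GI(1)])
    show "j \<in> ?C" by (simp add: cnbrs_def)
    show "y k j j - x k j = 0" for k by (simp add: x_eq[OF j])
    show "0 \<le> B / real (Suc k)" for k using B(1) by simp
  qed (rule order_refl \<open>w \<noteq> []\<close> w(2) q i)+
qed

lemma average_tendsto:
  assumes i: "i \<in> {1..N}" and j: "j \<in> cnbrs EI i"
  shows "(\<lambda>k. z k i j - x k j) \<longlonglongrightarrow> 0"
proof -
  have j': "j \<in> {1..N}" "i \<in> cnbrs EI j"
    using j cnbrs_subset[OF GI(1) i] cnbrs_sym[OF GI(1)] by blast+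
  have "(\<lambda>k. \<Sum>i'\<in>cnbrs EI j. \<bar>y k i' j - x k j\<bar>) \<longlonglongrightarrow> 0"
    using estimate_tendsto[OF j'(1)] by (intro tendsto_null_sum tendsto_rabs_zero)
  moreover have "norm (z k i j - x k j) \<le> (\<Sum>i'\<in>cnbrs EI j. \<bar>y k i' j - x k j\<bar>)" for k
  proof -
    have le: "\<bar>y k i' j - x k j\<bar> \<le> (\<Sum>i'\<in>cnbrs EI j. \<bar>y k i' j - x k j\<bar>)" if "i' \<in> cnbrs EI j" for i'
      using that finite_cnbrs[OF GI(1)] by (intro member_le_sum) auto
    show ?thesis
    proof (rule z_cases[OF i j, of k])
      fix i' assume i': "i' \<in> cnbrs EI j" and z: "z k i j = (y k i j + y k i' j) / 2"
      have "z k i j - x k j = (y k i j - x k j) / 2 + (y k i' j - x k j) / 2"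
        by (simp add: z field_simps)
      moreover have "\<bar>p / 2 + q / 2\<bar> \<le> s" if "\<bar>p\<bar> \<le> s" "\<bar>q\<bar> \<le> s" for p q s :: real
        using that by linarith
      ultimately show ?thesis using le[OF j'(2)] le[OF i'] by simp
    qed (use le[OF j'(2)] in simp)
  qed
  ultimately show ?thesis by (rule LIMSEQ_null_le)
qed

lemma gradient_error_tendsto:
  assumes i: "i \<in> {1..N}"
  shows "(\<lambda>k. g k i - pseudo_grad EI dJ (x k) i) \<longlonglongrightarrow> 0"
proof -
  have "(\<lambda>k. \<Sum>j\<in>nbrs EI i. \<bar>z k i j - x k j\<bar>) \<longlonglongrightarrow> 0"
    using average_tendsto[OF i] by (intro tendsto_null_sum tendsto_rabs_zero) (auto simp: cnbrs_def)
  from tendsto_mult[OF tendsto_const[of "L i"] this]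
  have "(\<lambda>k. L i * (\<Sum>j\<in>nbrs EI i. \<bar>z k i j - x k j\<bar>)) \<longlonglongrightarrow> 0" by simp
  moreover have "norm (g k i - pseudo_grad EI dJ (x k) i) \<le> L i * (\<Sum>j\<in>nbrs EI i. \<bar>z k i j - x k j\<bar>)" for k
  proof -
    have "\<bar>g k i - pseudo_grad EI dJ (x k) i\<bar> \<le> \<bar>\<sigma> i\<bar> * \<bar>x k i - x k i\<bar>
        + L i * (\<Sum>j\<in>nbrs EI i. \<bar>restrict (z k i) (nbrs EI i) j - restrict (x k) (nbrs EI i) j\<bar>)"
      unfolding g_def pseudo_grad_def
      by (rule lip_joint[OF i x_in'[OF i] x_in'[OF i] z_profile[OF i] restrict_profile[OF x_in]])
    also have "(\<Sum>j\<in>nbrs EI i. \<bar>restrict (z k i) (nbrs EI i) j - restrict (x k) (nbrs EI i) j\<bar>)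
        = (\<Sum>j\<in>nbrs EI i. \<bar>z k i j - x k j\<bar>)"
      by (intro sum.cong refl) simp
    finally show ?thesis by simp
  qed
  ultimately show ?thesis by (rule LIMSEQ_null_le)
qed

lemma x_tendsto:
  assumes "i \<in> {1..N}"
  shows "(\<lambda>k. x k i) \<longlonglongrightarrow> xs i"
proof -
  obtain C where C: "0 \<le> C" "\<And>i k. i \<in> {1..N} \<Longrightarrow> a k i \<le> C / real (Suc k)" using a_bound by blast
  obtain G where G: "0 \<le> G" "\<And>i k. i \<in> {1..N} \<Longrightarrow> \<bar>g k i\<bar> \<le> G" using g_bound by blast
  obtain D where D: "0 \<le> D" "\<And>i x y. i \<in> {1..N} \<Longrightarrow> x \<in> \<Omega> i \<Longrightarrow> y \<in> \<Omega> i \<Longrightarrow> \<bar>x - y\<bar> \<le> D"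
    using abs_diff_bound by blast
  obtain B where B: "0 \<le> B" "\<And>i k. i \<in> {1..N} \<Longrightarrow> \<bar>x (Suc k) i - x k i\<bar> \<le> B / real (Suc k)"
    using x_move_bound by blast
  obtain H where H: "0 \<le> H"
    "\<And>i x y. i \<in> {1..N} \<Longrightarrow> x \<in> (\<Pi>\<^sub>E i\<in>{1..N}. \<Omega> i) \<Longrightarrow> y \<in> (\<Pi>\<^sub>E i\<in>{1..N}. \<Omega> i) \<Longrightarrow>
       \<bar>gap x i - gap y i\<bar> \<le> H * (\<Sum>j\<in>{1..N}. \<bar>x j - y j\<bar>)"
    using gap_lipschitz by blast
  define r where "r i k = (\<Sum>s<k. a s i - 1 / real (Suc s))" for i k
  \<comment> \<open>Subtracting the limit turns the partial sums of the noise into a null sequence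
    with the same increments; this is what makes \<open>U\<close> and \<open>V\<close> below
    asymptotically equal.\<close>
  define \<rho> where "\<rho> i k = r i k - lim (r i)" for i k
  have \<rho>: "\<rho> i \<longlonglongrightarrow> 0" if "i \<in> {1..N}" for i
  proof -
    have "convergent (r i)" using step_noise_convergent[OF that] by (simp add: r_def[abs_def])
    then have "(\<lambda>k. r i k - lim (r i)) \<longlonglongrightarrow> 0" by (simp add: convergent_LIMSEQ_iff LIM_zero)
    then show ?thesis by (simp add: \<rho>_def[abs_def])
  qed
  have a_eq: "a k i = 1 / real (Suc k) + (\<rho> i (Suc k) - \<rho> i k)" for i k
    by (simp add: \<rho>_def r_def)
  define V where "V k = (\<Sum>i\<in>{1..N}. (x k i - xs i)\<^sup>2)" for k
  \<comment> \<open>Summation by parts: adding \<open>\<rho> * gap\<close> turns the noise \<open>a k i - 1 / (k + 1)\<close>, which is only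
      conditionally summable, into an error of order \<open>\<rho> / k\<close>.\<close>
  define U where "U k = V k + 2 * (\<Sum>i\<in>{1..N}. \<rho> i k * gap (x k) i)" for k
  define err where "err i k = g k i - pseudo_grad EI dJ (x k) i" for i k
  \<comment> \<open>The three parts are the change of \<open>gap\<close> weighted by the remaining
    noise, the error of the gradient, and the square of the step. A factor
    \<open>1 / (k + 1)\<close> is already taken out, and each part still tends to 0.\<close>
  define \<epsilon> where "\<epsilon> i k = 2 * \<bar>\<rho> i (Suc k)\<bar> * (H * (real N * B)) + 2 * C * D * \<bar>err i k\<bar>
      + C\<^sup>2 * G\<^sup>2 * (1 / real (Suc k))" for i k
  have xsi: "xs i \<in> \<Omega> i" if "i \<in> {1..N}" for i by (rule PiE_mem[OF xs that])
  have gap_move: "\<bar>gap (x (Suc k)) i - gap (x k) i\<bar> \<le> H * (real N * B) / real (Suc k)"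
    if i: "i \<in> {1..N}" for i k
  proof -
    have "\<bar>gap (x (Suc k)) i - gap (x k) i\<bar> \<le> H * (\<Sum>j\<in>{1..N}. \<bar>x (Suc k) j - x k j\<bar>)"
      by (rule H(2)[OF i x_in x_in])
    also have "\<dots> \<le> H * (\<Sum>j\<in>{1..N}. B / real (Suc k))"
      by (intro mult_left_mono sum_mono B(2) H(1))
    finally show ?thesis by simp
  qed
  have player: "(x (Suc k) i - xs i)\<^sup>2 + 2 * (\<rho> i (Suc k) * gap (x (Suc k)) i)
      \<le> (x k i - xs i)\<^sup>2 + 2 * (\<rho> i k * gap (x k) i)
        - 1 / real (Suc k) * (2 * gap (x k) i - \<epsilon> i k)" if i: "i \<in> {1..N}" for i k
  proof -
    define u where "u = x k i - xs i"
    define c where "c = 1 / real (Suc k)"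
    have c: "c > 0" by (simp add: c_def)
    have "\<bar>x (Suc k) i - xs i\<bar> \<le> \<bar>u - a k i * g k i\<bar>"
      using x_Suc_dist[OF i xsi[OF i], of k] by (simp add: u_def algebra_simps)
    then have "(x (Suc k) i - xs i)\<^sup>2 \<le> (u - a k i * g k i)\<^sup>2" by (simp add: abs_le_square_iff)
    also have "\<dots> = u\<^sup>2 - 2 * a k i * gap (x k) i - 2 * a k i * (err i k * u) + (a k i)\<^sup>2 * (g k i)\<^sup>2"
      by (simp add: u_def err_def gap_def power2_eq_square algebra_simps)
    finally have 1: "(x (Suc k) i - xs i)\<^sup>2 \<le> \<dots>" .
    have ac: "a k i \<le> C * c" using C(2)[OF i, of k] by (simp add: c_def)
    have "\<bar>err i k * u\<bar> \<le> \<bar>err i k\<bar> * D"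
      unfolding abs_mult u_def by (intro mult_left_mono D(2)[OF i x_in'[OF i] xsi[OF i]]) auto
    then have "a k i * \<bar>err i k * u\<bar> \<le> (C * c) * (\<bar>err i k\<bar> * D)"
      using ac C(1) c by (intro mult_mono) auto
    moreover have "- (a k i * (err i k * u)) \<le> a k i * \<bar>err i k * u\<bar>"
      using a_nonneg[of k i] by (metis abs_ge_minus_self mult_left_mono mult_minus_right)
    ultimately have 2: "- (a k i * (err i k * u)) \<le> c * (C * D * \<bar>err i k\<bar>)" by (simp add: mult_ac)
    have "(g k i)\<^sup>2 \<le> G\<^sup>2" using G(2)[OF i, of k] G(1) by (simp add: abs_le_square_iff[symmetric])
    then have "(a k i)\<^sup>2 * (g k i)\<^sup>2 \<le> (C * c)\<^sup>2 * G\<^sup>2"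
      using power_mono[OF ac a_nonneg, of 2] by (intro mult_mono) auto
    then have 3: "(a k i)\<^sup>2 * (g k i)\<^sup>2 \<le> c * (C\<^sup>2 * G\<^sup>2 * c)" by (simp add: power2_eq_square mult_ac)
    have "\<rho> i (Suc k) * (gap (x (Suc k)) i - gap (x k) i) \<le> \<bar>\<rho> i (Suc k)\<bar> * \<bar>gap (x (Suc k)) i - gap (x k) i\<bar>"
      by (metis abs_ge_self abs_mult)
    also have "\<dots> \<le> \<bar>\<rho> i (Suc k)\<bar> * (H * (real N * B) / real (Suc k))"
      by (intro mult_left_mono gap_move i) auto
    finally have 4: "\<rho> i (Suc k) * (gap (x (Suc k)) i - gap (x k) i) \<le> c * (\<bar>\<rho> i (Suc k)\<bar> * (H * (real N * B)))"
      by (simp add: c_def)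
    \<comment> \<open>The increment of \<open>\<rho> i\<close> cancels against the same term in
      \<open>\<rho> i (Suc k) * gap (x (Suc k)) i - \<rho> i k * gap (x k) i\<close>; what remains
      is the change of \<open>gap\<close> just bounded.\<close>
    have "a k i * gap (x k) i = c * gap (x k) i + (\<rho> i (Suc k) - \<rho> i k) * gap (x k) i"
      by (simp add: a_eq c_def distrib_right)
    then have "(x (Suc k) i - xs i)\<^sup>2 + 2 * (\<rho> i (Suc k) * gap (x (Suc k)) i)
      \<le> u\<^sup>2 + 2 * (\<rho> i k * gap (x k) i)
        - c * (2 * gap (x k) i - (2 * \<bar>\<rho> i (Suc k)\<bar> * (H * (real N * B)) + 2 * C * D * \<bar>err i k\<bar> + C\<^sup>2 * G\<^sup>2 * c))"
      using 1 2 3 4 by (simp add: algebra_simps)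
    then show ?thesis by (simp add: u_def c_def \<epsilon>_def)
  qed
  have "V \<longlonglongrightarrow> 0"
  proof (rule perturbed_descent_tendsto_0[where U = U and \<epsilon> = "\<lambda>k. \<Sum>i\<in>{1..N}. \<epsilon> i k" and \<gamma> = "\<lambda>k. 1 / real (Suc k)"
        and \<phi> = "\<lambda>k. 2 * (\<Sum>i\<in>{1..N}. gap (x k) i)"])
    show "0 \<le> V k" for k unfolding V_def by (intro sum_nonneg) auto
    have "(\<lambda>k. \<rho> i k * gap (x k) i) \<longlonglongrightarrow> 0" if i: "i \<in> {1..N}" for i
    proof (rule Lim_null_comparison)
      define K where "K = \<bar>gap xs i\<bar> + H * (\<Sum>j\<in>{1..N}. D)"
      have "\<bar>gap (x k) i\<bar> \<le> K" for k
      proof -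
        have "H * (\<Sum>j\<in>{1..N}. \<bar>x k j - xs j\<bar>) \<le> H * (\<Sum>j\<in>{1..N}. D)"
          by (intro mult_left_mono sum_mono D(2)[OF _ x_in' xsi] H(1))
        then show ?thesis using H(2)[OF i x_in[of k] xs] unfolding K_def by linarith
      qed
      then show "\<forall>\<^sub>F k in sequentially. norm (\<rho> i k * gap (x k) i) \<le> \<bar>\<rho> i k\<bar> * K"
        by (intro always_eventually allI) (simp add: abs_mult mult_left_mono)
      show "(\<lambda>k. \<bar>\<rho> i k\<bar> * K) \<longlonglongrightarrow> 0"
        by (intro tendsto_mult_left_zero tendsto_rabs_zero \<rho> i)
    qed
    then have "(\<lambda>k. 2 * (\<Sum>i\<in>{1..N}. \<rho> i k * gap (x k) i)) \<longlonglongrightarrow> 0"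
      by (intro tendsto_mult_right_zero tendsto_null_sum)
    then show "(\<lambda>k. U k - V k) \<longlonglongrightarrow> 0" by (simp add: U_def)
    show "U (Suc k) \<le> U k - 1 / real (Suc k) * (2 * (\<Sum>i\<in>{1..N}. gap (x k) i) - (\<Sum>i\<in>{1..N}. \<epsilon> i k))" for k
    proof -
      have "(\<Sum>i\<in>{1..N}. (x (Suc k) i - xs i)\<^sup>2 + 2 * (\<rho> i (Suc k) * gap (x (Suc k)) i))
          \<le> (\<Sum>i\<in>{1..N}. (x k i - xs i)\<^sup>2 + 2 * (\<rho> i k * gap (x k) i)
              - 1 / real (Suc k) * (2 * gap (x k) i - \<epsilon> i k))"
        by (rule sum_mono) (rule player)
      then show ?thesis
        by (simp only: U_def V_def sum.distrib sum_subtractf sum_distrib_left right_diff_distrib)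
    qed
    show "\<not> summable (\<lambda>k. 1 / real (Suc k))"
      using not_summable_harmonic[where 'a = real] summable_Suc_iff[of "\<lambda>n. 1 / real n"]
      by (simp add: inverse_eq_divide)
    show "0 \<le> 2 * (\<Sum>i\<in>{1..N}. gap (x k) i)" for k using gap_sum_nonneg[OF x_in] by simp
    show "\<exists>\<eta>>0. \<forall>k. \<delta> \<le> V k \<longrightarrow> \<eta> \<le> 2 * (\<Sum>i\<in>{1..N}. gap (x k) i)" if "\<delta> > 0" for \<delta>
    proof -
      obtain \<eta> where "\<eta> > 0" "\<And>x. x \<in> (\<Pi>\<^sub>E i\<in>{1..N}. \<Omega> i) \<Longrightarrow>
          \<delta> \<le> (\<Sum>i\<in>{1..N}. (x i - xs i)\<^sup>2) \<Longrightarrow> \<eta> \<le> (\<Sum>i\<in>{1..N}. gap x i)"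
        using gap_sum_uniform_pos[OF \<open>\<delta> > 0\<close>] by blast
      then show ?thesis using x_in unfolding V_def by (intro exI[of _ "2 * \<eta>"]) force
    qed
    have err: "err i \<longlonglongrightarrow> 0" if "i \<in> {1..N}" for i
      unfolding err_def by (rule gradient_error_tendsto[OF that])
    have "\<epsilon> i \<longlonglongrightarrow> 0" if "i \<in> {1..N}" for i
      unfolding \<epsilon>_def
      by (intro tendsto_add_zero tendsto_mult_left_zero tendsto_mult_right_zero tendsto_rabs_zero
          LIMSEQ_Suc[OF \<rho>] err LIMSEQ_Suc[OF lim_1_over_n] that)
    then show "(\<lambda>k. \<Sum>i\<in>{1..N}. \<epsilon> i k) \<longlonglongrightarrow> 0"
      by (intro tendsto_null_sum)
  qed auto
  have "(\<lambda>k. sqrt (V k)) \<longlonglongrightarrow> 0"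
    using tendsto_real_sqrt[OF \<open>V \<longlonglongrightarrow> 0\<close>] by simp
  moreover have "norm (x k i - xs i) \<le> sqrt (V k)" for k
  proof -
    have "(x k i - xs i)\<^sup>2 \<le> V k" unfolding V_def using assms by (intro member_le_sum) auto
    then show ?thesis by (simp add: real_le_rsqrt)
  qed
  ultimately have "(\<lambda>k. x k i - xs i) \<longlonglongrightarrow> 0"
    by (rule LIMSEQ_null_le)
  then show ?thesis by (simp add: LIM_zero_iff)
qed

end

section \<open>Almost every path is typical\<close>

theorem theorem2:
  fixes N :: nat
    and EI Em EC :: "(nat \<times> nat) set"
    and \<Omega> :: "nat \<Rightarrow> real set"
    and J dJ :: "nat \<Rightarrow> real \<Rightarrow> (nat \<Rightarrow> real) \<Rightarrow> real"
    and \<sigma> L :: "nat \<Rightarrow> real"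
    and x0 xstar :: "nat \<Rightarrow> real"
  assumes N2: "N \<ge> 2"
    and GI: "simple_graph {1..N} EI" "graph_connected {1..N} EI" "\<not> graph_complete {1..N} EI"
    and Gm: "max_triangle_free_spanning_subgraph {1..N} EI Em"
    and GC: "simple_graph {1..N} EC" "Em \<subseteq> EC" "EC \<subseteq> EI"
    and Omega: "\<And>i. i \<in> {1..N} \<Longrightarrow> \<Omega> i \<noteq> {} \<and> compact (\<Omega> i) \<and> convex (\<Omega> i)"
    and deriv: "\<And>i x u. i \<in> {1..N} \<Longrightarrow> x \<in> \<Omega> i \<Longrightarrow> u \<in> (\<Pi>\<^sub>E j\<in>nbrs EI i. \<Omega> j) \<Longrightarrow>
                  ((\<lambda>\<xi>. J i \<xi> u) has_real_derivative dJ i x u) (at x within \<Omega> i)"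
    and deriv_cont: "\<And>i u. i \<in> {1..N} \<Longrightarrow> u \<in> (\<Pi>\<^sub>E j\<in>nbrs EI i. \<Omega> j) \<Longrightarrow>
                  continuous_on (\<Omega> i) (\<lambda>x. dJ i x u)"
    and J_cont: "\<And>i. i \<in> {1..N} \<Longrightarrow>
                  continuous_on (\<Omega> i \<times> (\<Pi>\<^sub>E j\<in>nbrs EI i. \<Omega> j)) (\<lambda>(x, u). J i x u)"
    and J_convex: "\<And>i u. i \<in> {1..N} \<Longrightarrow> u \<in> (\<Pi>\<^sub>E j\<in>nbrs EI i. \<Omega> j) \<Longrightarrow>
                  convex_on (\<Omega> i) (\<lambda>x. J i x u)"
    and strict_mono: "\<And>x y. x \<in> (\<Pi>\<^sub>E i\<in>{1..N}. \<Omega> i) \<Longrightarrow> y \<in> (\<Pi>\<^sub>E i\<in>{1..N}. \<Omega> i) \<Longrightarrow> x \<noteq> y \<Longrightarrow>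
                  (\<Sum>i\<in>{1..N}. (pseudo_grad EI dJ x i - pseudo_grad EI dJ y i) * (x i - y i)) > 0"
    and sigma_pos: "\<And>i. i \<in> {1..N} \<Longrightarrow> \<sigma> i > 0"
    and L_pos: "\<And>i. i \<in> {1..N} \<Longrightarrow> L i > 0"
    and lip_own: "\<And>i u x y. i \<in> {1..N} \<Longrightarrow> u \<in> (\<Pi>\<^sub>E j\<in>nbrs EI i. \<Omega> j) \<Longrightarrow> x \<in> \<Omega> i \<Longrightarrow> y \<in> \<Omega> i \<Longrightarrow>
                  \<bar>dJ i x u - dJ i y u\<bar> \<le> \<sigma> i * \<bar>x - y\<bar>"
    and lip_others: "\<And>i x u v. i \<in> {1..N} \<Longrightarrow> x \<in> \<Omega> i \<Longrightarrow>
                  u \<in> (\<Pi>\<^sub>E j\<in>nbrs EI i. \<Omega> j) \<Longrightarrow> v \<in> (\<Pi>\<^sub>E j\<in>nbrs EI i. \<Omega> j) \<Longrightarrow>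
                  \<bar>dJ i x u - dJ i x v\<bar> \<le> L i * sqrt (\<Sum>j\<in>nbrs EI i. (u j - v j)\<^sup>2)"
    and init: "\<And>i j. i \<in> {1..N} \<Longrightarrow> j \<in> cnbrs EI i \<Longrightarrow> x0 (sidx EI i j) \<in> \<Omega> j"
    and NE: "is_nash_eq N EI \<Omega> J xstar"
  shows "AE \<omega> in gossip_space N EC.
           \<forall>i\<in>{1..N}. (\<lambda>k. gossip_traj N EI \<Omega> dJ x0 \<omega> k (sidx EI i i)) \<longlonglongrightarrow> xstar i"
proof -
  have variational: "0 \<le> pseudo_grad EI dJ xstar i * (z - xstar i)" if i: "i \<in> {1..N}" and z: "z \<in> \<Omega> i" for i z
  proof -
    have xstar: "xstar \<in> (\<Pi>\<^sub>E i\<in>{1..N}. \<Omega> i)" using NE by (simp add: is_nash_eq_def)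
    have u: "restrict xstar (nbrs EI i) \<in> (\<Pi>\<^sub>E j\<in>nbrs EI i. \<Omega> j)"
      using nbrs_subset[OF GI(1), of i] PiE_mem[OF xstar] by (intro restrict_PiE_iff[THEN iffD2]) blast
    show ?thesis
      unfolding pseudo_grad_def
    proof (rule first_order_optimality)
      show "convex (\<Omega> i)" using Omega[OF i] by blast
      show "((\<lambda>\<xi>. J i \<xi> (restrict xstar (nbrs EI i))) has_real_derivative
          dJ i (xstar i) (restrict xstar (nbrs EI i))) (at (xstar i) within \<Omega> i)"
        by (rule deriv[OF i PiE_mem[OF xstar i] u])
      show "J i (xstar i) (restrict xstar (nbrs EI i)) \<le> J i y (restrict xstar (nbrs EI i))" if "y \<in> \<Omega> i" for y
        using NE i that by (auto simp: is_nash_eq_def)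
    qed (use PiE_mem[OF xstar i] z in auto)
  qed
  interpret game: gossip_game N EI Em EC \<Omega> dJ \<sigma> L xstar
    using N2 GI(1,2) Gm GC(2,3) Omega strict_mono L_pos lip_own lip_others variational NE
    by unfold_locales (simp_all add: is_nash_eq_def)
  have EC_nbrs: "nbrs EC i \<noteq> {}" if i: "i \<in> {1..N}" for i
  proof -
    \<comment> \<open>An edge of \<open>EI\<close> at \<open>i\<close> either lies in
      \<open>Em\<close> or is bridged by a path whose first edge does; in both cases
      \<open>i\<close> has a communication partner.\<close>
    obtain j where "(i, j) \<in> EI" using game.nbrs_nonempty[OF i] by (auto simp: nbrs_def)
    then show ?thesis using edge_or_path2[OF GI(1) Gm] GC(2) unfolding nbrs_def by blast
  qed
  have supp: "set_pmf (select_pmf N EC) = EC"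
    using N2 by (intro set_select_pmf GC EC_nbrs) auto
  have "AE \<omega> in gossip_space N EC. stream_all (\<lambda>e. e \<in> EC) \<omega>"
    unfolding gossip_space_def
    by (rule prob_space.AE_stream_all[OF prob_space_measure_pmf]) (auto simp: AE_measure_pmf_iff supp)
  \<comment> \<open>Words form a countable type, so the null sets of all words can be
    united.\<close>
  moreover have "AE \<omega> in gossip_space N EC. \<forall>w. w \<noteq> [] \<longrightarrow> set w \<subseteq> EC \<longrightarrow> (\<exists>q>0.
      (\<lambda>n. real (card {t. t < n \<and> stake (length w) (sdrop (t * length w) \<omega>) = w}) / real n) \<longlonglongrightarrow> q)"
    unfolding AE_all_countable gossip_space_def
    using block_frequency_pos[of _ "{_}" "select_pmf N EC", unfolded supp] by simp
  moreover have "AE \<omega> in gossip_space N EC. \<forall>i. i \<in> {1..N} \<longrightarrow> (\<exists>p>0.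
      (\<lambda>n. real (card {t. t < n \<and> (fst (\<omega> !! t) = i \<or> snd (\<omega> !! t) = i)}) / real n) \<longlonglongrightarrow> p)"
    unfolding AE_all_countable
  proof
    fix i
    show "AE \<omega> in gossip_space N EC. i \<in> {1..N} \<longrightarrow> (\<exists>p>0.
      (\<lambda>n. real (card {t. t < n \<and> (fst (\<omega> !! t) = i \<or> snd (\<omega> !! t) = i)}) / real n) \<longlonglongrightarrow> p)"
    proof (cases "i \<in> {1..N}")
      case True
      then obtain j where "(i, j) \<in> EC" using EC_nbrs by (auto simp: nbrs_def)
      then show ?thesis
        unfolding gossip_space_def
        \<comment> \<open>Blocks of one letter: \<open>j\<close> is any partner of \<open>i\<close>,
          and the event is that \<open>i\<close> takes part in either role.\<close>
        using block_frequency_pos[of "[(i, j)]" "{w. fst (hd w) = i \<or> snd (hd w) = i}" "select_pmf N EC"]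
        by (simp add: supp)
    next
      case False
      then show ?thesis by (intro AE_I2) blast
    qed
  qed
  ultimately show ?thesis
  proof eventually_elim
    case (elim \<omega>)
    interpret path: gossip_path N EI Em EC \<Omega> dJ \<sigma> L xstar x0 \<omega>
      using init elim by unfold_locales (simp_all add: stream_all_def)
    show ?case
      using path.x_tendsto by (simp add: path.x_eq path.y_def)
  qed
qed

end
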